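(* Under Assumptions (S1), (S2), (S3) below, if $\eta_t\le2/(\kappa^2L)$ for all $t$, then for all $t\in\mathbb N$ $$\mathbb E[\mathcal E(\overline w_t)-\inf_{w\in\mathcal F}\mathcal E(w)]\lesssim\frac{\sum_{k=1}^t\eta_k}{n}+\frac{\sum_{k=1}^t\eta_k^2}{\sum_{k=1}^t\eta_k}+\Big(\frac1{\sum_{k=1}^t\eta_k}\Big)^\beta$$ and $$\mathbb E[\mathcal E(w_t)-\inf_{w}\mathcal E(w)]\lesssim\frac{\sum_{k=1}^t\eta_k}{n}\sum_{k=1}^{t-1}\frac{\eta_k}{\eta_t(t-k)}+\Big(\sum_{k=1}^{t-1}\frac{\eta_k^2}{\eta_t(t-k)}+\eta_t\Big)+\frac{(\sum_{k=1}^t\eta_k)^{1-\beta}}{\eta_tt}.$$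
   Context: Setting: $\rho$ on $\mathcal X\times\mathcal Y$, $\mathcal Y\subseteq\mathbb R$, sample of size $n$ i.i.d.; measurable $\Phi:\mathcal X\to\mathcal F$ (separable Hilbert space); $\mathcal E(w)=\int\ell(y,\langle w,\Phi(x)\rangle)d\rho$. SGM with non-increasing step-sizes $\eta_t>0$: $w_1=0$, $w_{t+1}=w_t-\eta_t\ell'_-(y_{j_t},\langle w_t,\Phi(x_{j_t})\rangle)\Phi(x_{j_t})$, $j_t$ i.i.d. uniform on $\{1,\dots,n\}$; $\overline w_t=\sum_{k\le t}\eta_kw_k/\sum_{k\le t}\eta_k$; $\mathbb E$ over sample and indices. $a\lesssim b$ means $a\le Cb$ with $C$ independent of $n$ and $t$. (S1) $\kappa=\sup_x\|\Phi(x)\|<\infty$; $\ell(y,\cdot)$ convex; $\sup_y\ell(y,0)<\infty$; $|\ell'_-(y,a)|\le a_0$ for all $a,y$. (S2) With $\mathcal D(\lambda)=\inf_w\{\mathcal E(w)+\frac\lambda2\|w\|^2\}-\inf_w\mathcal E(w)$, there are $\beta\in(0,1]$, $c_\beta>0$ with $\mathcal D(\lambda)\le c_\beta\lambda^\beta$ for all $\lambda>0$. (S3) for all $y$, $\ell(y,\cdot)$ is differentiable and $\ell'(y,\cdot)$ is $L$-Lipschitz. *)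

theory Defs
  imports "HOL-Probability.Probability"
begin

definition left_deriv :: "(real \<Rightarrow> real) \<Rightarrow> real \<Rightarrow> real" where
  "left_deriv f a = Lim (at_left 0) (\<lambda>h. (f (a + h) - f a) / h)"

definition risk :: "('x \<times> real) measure \<Rightarrow> (real \<Rightarrow> real \<Rightarrow> real) \<Rightarrow> ('x \<Rightarrow> 'f::real_inner) \<Rightarrow> 'f \<Rightarrow> real" where
  "risk \<rho> l \<Phi> w = (\<integral>z. l (snd z) (inner w (\<Phi> (fst z))) \<partial>\<rho>)"

definition inf_risk :: "('x \<times> real) measure \<Rightarrow> (real \<Rightarrow> real \<Rightarrow> real) \<Rightarrow> ('x \<Rightarrow> 'f::real_inner) \<Rightarrow> real" where
  "inf_risk \<rho> l \<Phi> = Inf (range (risk \<rho> l \<Phi>))"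

definition approx_err :: "('x \<times> real) measure \<Rightarrow> (real \<Rightarrow> real \<Rightarrow> real) \<Rightarrow> ('x \<Rightarrow> 'f::real_inner) \<Rightarrow> real \<Rightarrow> real" where
  "approx_err \<rho> l \<Phi> lam =
     Inf (range (\<lambda>w. risk \<rho> l \<Phi> w + lam / 2 * (norm w)\<^sup>2)) - inf_risk \<rho> l \<Phi>"

text \<open>SGM iterates: \<open>sgm_aux \<dots> k = w_{k+1}\<close>; the sample is \<open>zs 1, \<dots>, zs n\<close>,
  the indices are \<open>js 1, js 2, \<dots>\<close>.\<close>
primrec sgm_aux :: "(real \<Rightarrow> real \<Rightarrow> real) \<Rightarrow> ('x \<Rightarrow> 'f::real_inner) \<Rightarrow> (nat \<Rightarrow> real)
    \<Rightarrow> (nat \<Rightarrow> 'x \<times> real) \<Rightarrow> (nat \<Rightarrow> nat) \<Rightarrow> nat \<Rightarrow> 'f" where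
  "sgm_aux l \<Phi> \<eta> zs js 0 = 0"
| "sgm_aux l \<Phi> \<eta> zs js (Suc k) =
     (let w = sgm_aux l \<Phi> \<eta> zs js k; z = zs (js (Suc k))
      in w - (\<eta> (Suc k) * left_deriv (l (snd z)) (inner w (\<Phi> (fst z)))) *\<^sub>R \<Phi> (fst z))"

text \<open>\<open>w_t\<close> for \<open>t \<ge> 1\<close>.\<close>
definition sgm_iter :: "(real \<Rightarrow> real \<Rightarrow> real) \<Rightarrow> ('x \<Rightarrow> 'f::real_inner) \<Rightarrow> (nat \<Rightarrow> real)
    \<Rightarrow> (nat \<Rightarrow> 'x \<times> real) \<Rightarrow> (nat \<Rightarrow> nat) \<Rightarrow> nat \<Rightarrow> 'f" where
  "sgm_iter l \<Phi> \<eta> zs js t = sgm_aux l \<Phi> \<eta> zs js (t - 1)"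

definition sgm_avg :: "(real \<Rightarrow> real \<Rightarrow> real) \<Rightarrow> ('x \<Rightarrow> 'f::real_inner) \<Rightarrow> (nat \<Rightarrow> real)
    \<Rightarrow> (nat \<Rightarrow> 'x \<times> real) \<Rightarrow> (nat \<Rightarrow> nat) \<Rightarrow> nat \<Rightarrow> 'f" where
  "sgm_avg l \<Phi> \<eta> zs js t =
     (1 / (\<Sum>k=1..t. \<eta> k)) *\<^sub>R (\<Sum>k=1..t. \<eta> k *\<^sub>R sgm_iter l \<Phi> \<eta> zs js k)"

definition sample_index_measure :: "('x \<times> real) measure \<Rightarrow> nat \<Rightarrow> ((nat \<Rightarrow> 'x \<times> real) \<times> (nat \<Rightarrow> nat)) measure" where
  "sample_index_measure \<rho> n =
     (PiM {1..n} (\<lambda>_. \<rho>)) \<Otimes>\<^sub>M (PiM UNIV (\<lambda>_. measure_pmf (pmf_of_set {1..n})))"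

end

theory Submission
  imports Defs
begin

text \<open>For a convex smooth loss and \<open>\<eta>\<^sub>t \<le> 2 / (\<kappa>\<^sup>2 L)\<close> a gradient step is nonexpansive. Replacing one
  training point by an independent copy therefore moves \<open>w\<^sub>k\<close> only through the steps that use
  this point, and on average over the points the expected gap between empirical and true risk at
  \<open>w\<^sub>k\<close> is at most \<open>2 (\<kappa> a\<^sub>0)\<^sup>2 (\<eta>\<^sub>1 + \<dots> + \<eta>\<^bsub>k-1\<^esub>) / n\<close>. The usual regret inequality for
  the empirical risk, started from 0 and compared with a fixed \<open>u\<close>, then yields the bound for the
  averaged iterate once \<open>u\<close> is optimised with \<open>\<lambda> = 1 / \<Sum>\<eta>\<^sub>k\<close>. Restarting the same inequality at
  \<open>w\<^sub>s\<close> and comparing with \<open>w\<^sub>s\<close> itself bounds the excess over each suffix, and averaging over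
  suffixes passes from the averaged to the last iterate.

  Since \<open>Y\<close> need not be measurable and nothing is assumed about the loss off \<open>Y\<close>, the argument is
  run with a centred loss and a gradient that are set to 0 off a measurable set of full measure.\<close>

section \<open>Measurability and resampling\<close>

text \<open>The argument \<open>w\<close> is replaced by the first point of a dense sequence within
  \<open>1 / Suc k\<close> of it. That index is measurable with countable range, so each
  approximation is measurable; continuity gives the limit.\<close>

lemma borel_measurable_Caratheodory:
  fixes H :: "'a::{second_countable_topology, metric_space} \<Rightarrow> 'z \<Rightarrow> 'b::metric_space"
  assumes cont: "\<And>z. continuous_on UNIV (\<lambda>w. H w z)"
    and meas [measurable]: "\<And>w. H w \<in> borel_measurable M"
  shows "(\<lambda>(w, z). H w z) \<in> borel_measurable (borel \<Otimes>\<^sub>M M)"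
proof -
  obtain D :: "'a set" where D: "countable D" "\<And>X. open X \<Longrightarrow> X \<noteq> {} \<Longrightarrow> \<exists>d\<in>D. d \<in> X"
    using countable_dense_setE by blast
  define e where "e = from_nat_into D"
  define i where "i k w = (LEAST i. dist (e i) w < 1 / Suc k)" for k :: nat and w
  have i: "dist (e (i k w)) w < 1 / Suc k" for k w
  proof -
    obtain d where "d \<in> D" "d \<in> ball w (1 / Suc k)" using D(2)[of "ball w (1 / Suc k)"] by auto
    moreover obtain j where "e j = d"
      using \<open>d \<in> D\<close> D(1) by (metis e_def from_nat_into_surj)
    ultimately have "dist (e j) w < 1 / Suc k" by (simp add: dist_commute)
    then show ?thesis unfolding i_def by (rule LeastI)
  qed
  have [measurable]: "(\<lambda>p. i k (fst p)) \<in> measurable (borel \<Otimes>\<^sub>M M) (count_space UNIV)" for k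
    unfolding i_def by measurable
  show ?thesis
  proof (rule borel_measurable_LIMSEQ_metric)
    show "(\<lambda>p. H (e (i k (fst p))) (snd p)) \<in> borel_measurable (borel \<Otimes>\<^sub>M M)" for k
      by (rule measurable_compose_countable[where f="\<lambda>i p. H (e i) (snd p)"]) measurable
    fix p :: "'a \<times> 'z"
    have "(\<lambda>k. 1 / real (Suc k)) \<longlonglongrightarrow> 0"
      by (rule LIMSEQ_Suc[OF lim_1_over_n])
    then have "(\<lambda>k. dist (e (i k (fst p))) (fst p)) \<longlonglongrightarrow> 0"
      by (rule Lim_null_comparison[rotated])
         (intro always_eventually allI, unfold real_norm_def abs_of_nonneg[OF zero_le_dist],
          rule less_imp_le[OF i])
    then have "(\<lambda>k. e (i k (fst p))) \<longlonglongrightarrow> fst p"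
      by (rule tendsto_dist_iff[THEN iffD2])
    moreover have "isCont (\<lambda>w. H w (snd p)) (fst p)"
      using cont[of "snd p"] by (simp add: continuous_on_eq_continuous_at)
    ultimately have "(\<lambda>k. H (e (i k (fst p))) (snd p)) \<longlonglongrightarrow> H (fst p) (snd p)"
      by (rule isCont_tendsto_compose[rotated])
    then show "(\<lambda>k. H (e (i k (fst p))) (snd p)) \<longlonglongrightarrow> (case p of (w, z) \<Rightarrow> H w z)"
      by (simp only: split_beta)
  qed
qed

text \<open>Overwriting coordinate \<open>k\<close> by an independent draw from \<open>M k\<close>
  leaves the product measure unchanged, because \<open>insert k I = I\<close>; Fubini then splits
  off the draw.\<close>

lemma integral_PiM_resample:
  fixes f :: "('i \<Rightarrow> 'a) \<Rightarrow> real"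
  assumes M: "\<And>i. i \<in> I \<Longrightarrow> prob_space (M i)" and k: "k \<in> I"
    and f [measurable]: "f \<in> borel_measurable (PiM I M)"
    and bdd: "\<And>x. \<bar>f x\<bar> \<le> B"
  shows "(\<integral>x. f x \<partial>PiM I M) = (\<integral>x. (\<integral>y. f (x(k := y)) \<partial>M k) \<partial>PiM I M)"
proof -
  interpret k: prob_space "M k" using M k .
  interpret I: prob_space "PiM I M" by (intro prob_space_PiM M)
  interpret kI: pair_prob_space "M k" "PiM I M" ..
  have ins: "insert k I = I" using k by auto
  have [measurable]: "(\<lambda>(y, x). x(k := y)) \<in> M k \<Otimes>\<^sub>M PiM I M \<rightarrow>\<^sub>M PiM I M"
    using measurable_add_dim[of k I M]
    by (subst measurable_pair_swap_iff) (simp add: ins split_beta')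
  have "(\<integral>x. f x \<partial>PiM I M) = (\<integral>x. f x \<partial>distr (M k \<Otimes>\<^sub>M PiM I M) (PiM I M) (\<lambda>(y, x). x(k := y)))"
    using distr_pair_PiM_eq_PiM[of I M k] M k by (simp add: ins)
  also have "\<dots> = (\<integral>p. f ((\<lambda>(y, x). x(k := y)) p) \<partial>(M k \<Otimes>\<^sub>M PiM I M))"
    by (rule integral_distr) measurable
  also have "\<dots> = (\<integral>p. (\<lambda>(y, x). f (x(k := y))) p \<partial>(M k \<Otimes>\<^sub>M PiM I M))"
    by (simp add: split_beta')
  also have "\<dots> = (\<integral>x. (\<integral>y. f (x(k := y)) \<partial>M k) \<partial>PiM I M)"
  proof (rule kI.integral_snd[symmetric], rule kI.integrable_const_bound)
    show "(\<lambda>(y, x). f (x(k := y))) \<in> borel_measurable (M k \<Otimes>\<^sub>M PiM I M)"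
      using measurable_compose[OF \<open>(\<lambda>(y, x). x(k := y)) \<in> _\<close> f] by (simp add: split_beta')
    show "AE p in M k \<Otimes>\<^sub>M Pi\<^sub>M I M. norm (case p of (y, x) \<Rightarrow> f (x(k := y))) \<le> B"
      using bdd by (auto simp: split_beta')
  qed
  finally show ?thesis .
qed

lemma left_deriv_eq_deriv:
  assumes "f differentiable (at a)"
  shows "left_deriv f a = deriv f a"
proof -
  have "((\<lambda>h. (f (a + h) - f a) / h) \<longlongrightarrow> deriv f a) (at 0)"
    using assms by (simp add: DERIV_deriv_iff_real_differentiable[symmetric] DERIV_def)
  then have "((\<lambda>h. (f (a + h) - f a) / h) \<longlongrightarrow> deriv f a) (at_left 0)"
    by (rule tendsto_within_subset) simp
  then show ?thesis unfolding left_deriv_def by (intro tendsto_Lim) simp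
qed

text \<open>\<open>\<Phi>\<close> itself serves as a test direction: the difference quotients of \<open>h \<mapsto> m (w + h \<Phi>)\<close> converge
  to \<open>l' \<parallel>\<Phi>\<parallel>\<^sup>2\<close>, and division by \<open>\<parallel>\<Phi>\<parallel>\<^sup>2\<close> is harmless because the gradient vanishes where \<open>\<Phi>\<close> does.\<close>
lemma gradient_measurable:
  fixes \<Phi> :: "'z \<Rightarrow> 'f::{real_inner, second_countable_topology}" and l :: "'z \<Rightarrow> real \<Rightarrow> real"
  assumes Phi [measurable]: "\<Phi> \<in> borel_measurable M"
    and diff: "\<And>z a. z \<in> A \<Longrightarrow> l z differentiable (at a)"
    and meas: "\<And>w. (\<lambda>z. if z \<in> A then l z (inner w (\<Phi> z)) - l z 0 else 0) \<in> borel_measurable M"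
  shows "(\<lambda>z. if z \<in> A then deriv (l z) (inner w (\<Phi> z)) *\<^sub>R \<Phi> z else 0) \<in> borel_measurable M"
proof -
  define m where "m w z = (if z \<in> A then l z (inner w (\<Phi> z)) - l z 0 else 0)" for w z
  have l_cont: "continuous_on UNIV (l z)" if "z \<in> A" for z
    using diff[OF that] differentiable_imp_continuous_within by (auto simp: continuous_on_eq_continuous_within)
  have cont: "continuous_on UNIV (\<lambda>w. m w z)" for z
    unfolding m_def by (cases "z \<in> A")
      (auto intro!: continuous_intros continuous_on_compose2[OF l_cont])
  \<comment> \<open>The arguments used below move with \<open>z\<close>, so measurability for each
    fixed \<open>w\<close> has to become joint measurability.\<close>
  have "(\<lambda>(w, z). m w z) \<in> borel_measurable (borel \<Otimes>\<^sub>M M)"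
    using cont meas unfolding m_def[symmetric] by (rule borel_measurable_Caratheodory)
  then have [measurable]: "(\<lambda>z. m (W z) z) \<in> borel_measurable M" if "W \<in> borel_measurable M" for W
    using measurable_compose[of "\<lambda>z. (W z, z)" M "borel \<Otimes>\<^sub>M M" "\<lambda>(w, z). m w z"] that by simp
  let ?c = "\<lambda>z. if z \<in> A then deriv (l z) (inner w (\<Phi> z)) * (norm (\<Phi> z))\<^sup>2 else 0"
  have "?c \<in> borel_measurable M"
  proof (rule borel_measurable_LIMSEQ_real)
    show "(\<lambda>z. (m (w + (1 / real (Suc k)) *\<^sub>R \<Phi> z) z - m w z) / (1 / real (Suc k))) \<in> borel_measurable M" for k
      by measurable
    fix z
    show "(\<lambda>k. (m (w + (1 / real (Suc k)) *\<^sub>R \<Phi> z) z - m w z) / (1 / real (Suc k))) \<longlonglongrightarrow> ?c z"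
    proof (cases "z \<in> A")
      case True
      have "((\<lambda>h. l z (inner w (\<Phi> z) + h * (norm (\<Phi> z))\<^sup>2)) has_real_derivative
          deriv (l z) (inner w (\<Phi> z)) * (norm (\<Phi> z))\<^sup>2) (at 0)"
        by (rule DERIV_chain2[where f="l z"])
           (use diff[OF True] in \<open>auto simp: DERIV_deriv_iff_real_differentiable intro!: derivative_eq_intros\<close>)
      then have "((\<lambda>h. (l z (inner w (\<Phi> z) + h * (norm (\<Phi> z))\<^sup>2) - l z (inner w (\<Phi> z))) / h)
          \<longlongrightarrow> deriv (l z) (inner w (\<Phi> z)) * (norm (\<Phi> z))\<^sup>2) (at 0)"
        by (simp add: DERIV_def)
      moreover have "filterlim (\<lambda>k. 1 / real (Suc k)) (at 0) sequentially"
        using LIMSEQ_Suc[OF lim_1_over_n[where 'a=real]] by (auto simp: filterlim_at)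
      ultimately show ?thesis
        using True by (auto simp: m_def inner_add_left power2_norm_eq_inner dest: filterlim_compose)
    qed (simp add: m_def)
  qed
  then have "(\<lambda>z. (?c z / (norm (\<Phi> z))\<^sup>2) *\<^sub>R \<Phi> z) \<in> borel_measurable M"
    by measurable
  also have "(\<lambda>z. (?c z / (norm (\<Phi> z))\<^sup>2) *\<^sub>R \<Phi> z)
    = (\<lambda>z. if z \<in> A then deriv (l z) (inner w (\<Phi> z)) *\<^sub>R \<Phi> z else 0)"
    by (auto simp: fun_eq_iff)
  finally show ?thesis .
qed

section \<open>From suffix averages to the last iterate\<close>

text \<open>With \<open>y k = \<eta> k * a k - x k\<close>, induction on \<open>j\<close> bounds \<open>\<eta> t * a t\<close> by the mean of \<open>y\<close> over the last
  \<open>j\<close> indices plus the weighted \<open>x k\<close> collected so far; enlarging the window by one index costs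
  exactly one application of \<open>restart\<close>.\<close>
lemma last_iterate_le:
  fixes \<eta> a x :: "nat \<Rightarrow> real"
  assumes t: "1 \<le> t"
    and pos: "\<And>k. 1 \<le> k \<Longrightarrow> 0 < \<eta> k" and decr: "\<And>k l. 1 \<le> k \<Longrightarrow> k \<le> l \<Longrightarrow> \<eta> l \<le> \<eta> k"
    and a: "\<And>k. 0 \<le> a k"
    and initial: "(\<Sum>k=1..t. \<eta> k * a k) \<le> V + (\<Sum>k=1..t. x k)"
    and restart: "\<And>s. 1 \<le> s \<Longrightarrow> s \<le> t \<Longrightarrow> (\<Sum>k=s..t. \<eta> k * (a k - a s)) \<le> (\<Sum>k=s..t. x k)"
  shows "\<eta> t * a t \<le> V / t + x t + (\<Sum>k=1..t-1. x k / real (t - k))"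
proof -
  define y where "y k = \<eta> k * a k - x k" for k
  \<comment> \<open>At \<open>k = t\<close> the quotient would be 0 by division by zero, whereas
    \<open>x t\<close> has to count fully.\<close>
  define c :: "nat \<Rightarrow> real" where "c k = (if k = t then 1 else 1 / real (t - k))" for k
  have "\<eta> t * a t \<le> (\<Sum>k=t+1-j..t. y k) / j + (\<Sum>k=t+1-j..t. c k * x k)" if "1 \<le> j" "j \<le> t" for j
    using that
  proof (induction j rule: dec_induct)
    case base
    then show ?case by (simp add: y_def c_def)
  next
    case (step j)
    define s where "s = t - j"
    have s: "1 \<le> s" "s < t" "t + 1 - j = Suc s" "t + 1 - Suc j = s" "t - s = j" "real (t - s) = j"
      using step.hyps step.prems unfolding s_def by auto
    have j: "0 < real j" using step.hyps by simp
    have c_s: "c s = 1 / j" unfolding c_def s(6) using s(2) by simp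
    have "(\<Sum>k=s..t. \<eta> k * (a k - a s)) = (\<Sum>k=Suc s..t. \<eta> k * (a k - a s))"
      using s by (simp add: sum.atLeast_Suc_atMost)
    also have "\<dots> = (\<Sum>k=Suc s..t. \<eta> k * a k) - (\<Sum>k=Suc s..t. \<eta> k * a s)"
      by (simp add: right_diff_distrib sum_subtractf)
    finally have "(\<Sum>k=Suc s..t. \<eta> k * a k) \<le> (\<Sum>k=s..t. x k) + (\<Sum>k=Suc s..t. \<eta> k * a s)"
      using restart[of s] s by simp
    \<comment> \<open>Non-increasing steps and \<open>0 \<le> a s\<close> make the comparison term a
      multiple of \<open>\<eta> s * a s\<close>, the main part of \<open>y s\<close>.\<close>
    also have "(\<Sum>k=Suc s..t. \<eta> k * a s) \<le> (\<Sum>k=Suc s..t. \<eta> s * a s)"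
      using s a by (intro sum_mono mult_right_mono decr) auto
    also have "\<dots> = j * (\<eta> s * a s)" using s by simp
    finally have "(\<Sum>k=Suc s..t. y k) \<le> x s + j * (\<eta> s * a s)"
      using s by (simp add: y_def sum_subtractf sum.atLeast_Suc_atMost[of s])
    then have "(\<Sum>k=Suc s..t. y k) / j \<le> (\<Sum>k=s..t. y k) / Suc j + x s / j"
    proof -
      \<comment> \<open>Applied with \<open>Z\<close> the sum of \<open>y\<close> over the old
        window, \<open>e = \<eta> s * a s\<close> and \<open>u = x s\<close>, so that
        \<open>e - u\<close> is the new summand \<open>y s\<close>.\<close>
      have *: "Z / j \<le> (e - u + Z) / Suc j + u / j" if "Z \<le> u + j * e" for Z e u :: real
      proof -
        have "(Z - u) * Suc j \<le> (e - u + Z) * j" using that by (simp add: algebra_simps)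
        then have "(Z - u) / j \<le> (e - u + Z) / Suc j"
          by (subst pos_le_divide_eq, simp, subst times_divide_eq_left, subst pos_divide_le_eq[OF j])
        then show ?thesis using diff_divide_distrib[of Z u "real j"] by linarith
      qed
      have "(\<Sum>k=s..t. y k) = \<eta> s * a s - x s + (\<Sum>k=Suc s..t. y k)"
        using s by (simp add: sum.atLeast_Suc_atMost[of s] y_def)
      then show ?thesis
        by (simp only: *[OF \<open>(\<Sum>k=Suc s..t. y k) \<le> _\<close>])
    qed
    moreover have "(\<Sum>k=s..t. c k * x k) = x s / j + (\<Sum>k=Suc s..t. c k * x k)"
      using c_s by (simp add: sum.atLeast_Suc_atMost[OF less_imp_le[OF s(2)]])
    moreover have "\<eta> t * a t \<le> (\<Sum>k=Suc s..t. y k) / j + (\<Sum>k=Suc s..t. c k * x k)"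
      using step.IH[unfolded s(3)] step.prems by simp
    ultimately show ?case unfolding s(4) by linarith
  qed
  from this[of t] have "\<eta> t * a t \<le> (\<Sum>k=1..t. y k) / t + (\<Sum>k=1..t. c k * x k)"
    using t by simp
  also have "(\<Sum>k=1..t. y k) / t \<le> V / t"
    using initial by (intro divide_right_mono) (auto simp: y_def sum_subtractf)
  also have "(\<Sum>k=1..t. c k * x k) = x t + (\<Sum>k=1..t-1. x k / real (t - k))"
  proof -
    have "(\<Sum>k=1..t. c k * x k) = c t * x t + (\<Sum>k=1..t-1. c k * x k)"
      using t by (cases t) auto
    also have "(\<Sum>k=1..t-1. c k * x k) = (\<Sum>k=1..t-1. x k / real (t - k))"
      by (intro sum.cong) (auto simp: c_def)
    finally show ?thesis by (simp add: c_def)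
  qed
  finally show ?thesis by simp
qed

section \<open>Smooth convex losses\<close>

text \<open>\<open>m\<close> models the loss centred at 0 and \<open>G\<close> its gradient in
  \<open>w\<close>, with \<open>K = \<kappa> * a0\<close> and
  \<open>M = \<kappa>\<^sup>2 * L\<close>. The inequalities hold at every \<open>z\<close>, so
  pathwise arguments need no exceptional sets.\<close>

locale smooth_convex_loss = prob_space \<rho> for \<rho> :: "'z measure" +
  fixes m :: "'f::{real_inner, second_countable_topology} \<Rightarrow> 'z \<Rightarrow> real"
    and G :: "'f \<Rightarrow> 'z \<Rightarrow> 'f" and K M :: real
  assumes m_measurable [measurable]: "\<And>w. m w \<in> borel_measurable \<rho>"
    and G_measurable [measurable]: "\<And>w. G w \<in> borel_measurable \<rho>"
    and m_zero: "\<And>z. m 0 z = 0"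
    and G_bound: "\<And>w z. norm (G w z) \<le> K"
    and M_nonneg: "0 \<le> M"
    and subgradient: "\<And>u w z. m w z + inner (G w z) (u - w) \<le> m u z"
    and cocoercive: "\<And>u w z. (norm (G w z - G u z))\<^sup>2 \<le> M * inner (G w z - G u z) (w - u)"
begin

definition R :: "'f \<Rightarrow> real" where "R w = (\<integral>z. m w z \<partial>\<rho>)"

lemma K_nonneg: "0 \<le> K"
  using order_trans[OF norm_ge_zero G_bound] .

lemma m_lipschitz: "\<bar>m w z - m u z\<bar> \<le> K * norm (w - u)"
proof -
  have "\<bar>inner (G v z) (w - u)\<bar> \<le> K * norm (w - u)" for v
    by (rule order_trans[OF Cauchy_Schwarz_ineq2 mult_right_mono]) (auto simp: G_bound)
  from this[of w] this[of u] show ?thesis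
    using subgradient[of w z u] subgradient[of u z w]
    unfolding abs_le_iff inner_diff_right by linarith
qed

lemma m_bound: "\<bar>m w z\<bar> \<le> K * norm w"
  using m_lipschitz[of w z 0] by (simp add: m_zero)

lemma m_integrable: "integrable \<rho> (m w)"
  by (rule integrable_const_bound[where B="K * norm w"]) (auto simp: m_bound)

lemma R_lipschitz: "\<bar>R w - R u\<bar> \<le> K * norm (w - u)"
proof -
  have "\<bar>R w - R u\<bar> = \<bar>\<integral>z. m w z - m u z \<partial>\<rho>\<bar>"
    by (simp add: R_def m_integrable)
  also have "\<dots> \<le> (\<integral>z. \<bar>m w z - m u z\<bar> \<partial>\<rho>)" by simp
  also have "\<dots> \<le> (\<integral>z. K * norm (w - u) \<partial>\<rho>)"
    by (intro integral_mono) (auto simp: m_lipschitz m_integrable)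
  finally show ?thesis by (simp add: prob_space)
qed

lemma R_bound: "\<bar>R w\<bar> \<le> K * norm w"
  using R_lipschitz[of w 0] by (simp add: R_def m_zero)

lemma continuous_m: "continuous_on UNIV (\<lambda>w. m w z)"
  by (rule lipschitz_on_continuous_on[where L=K])
     (auto simp: lipschitz_on_def K_nonneg dist_norm m_lipschitz)

lemma continuous_R: "continuous_on UNIV R"
  by (rule lipschitz_on_continuous_on[where L=K])
     (auto simp: lipschitz_on_def K_nonneg dist_norm R_lipschitz)

lemma R_measurable [measurable]: "R \<in> borel_measurable borel"
  using continuous_R by (rule borel_measurable_continuous_onI)

text \<open>Cocoercivity with Cauchy-Schwarz. It makes \<open>G\<close> continuous in
  \<open>w\<close>, on which the measurability of the iterates rests.\<close>

lemma G_lipschitz: "norm (G w z - G u z) \<le> M * norm (w - u)"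
proof (cases "G w z = G u z")
  case False
  have "(norm (G w z - G u z))\<^sup>2 \<le> M * (norm (G w z - G u z) * norm (w - u))"
    by (rule order_trans[OF cocoercive mult_left_mono[OF norm_cauchy_schwarz M_nonneg]])
  then have "norm (G w z - G u z) * norm (G w z - G u z) \<le> norm (G w z - G u z) * (M * norm (w - u))"
    by (simp add: power2_eq_square mult_ac)
  then show ?thesis by (rule mult_left_le_imp_le) (use False in simp)
qed (simp add: M_nonneg)

lemma continuous_G: "continuous_on UNIV (\<lambda>w. G w z)"
  by (rule lipschitz_on_continuous_on[where L=M])
     (auto simp: lipschitz_on_def M_nonneg dist_norm G_lipschitz)

text \<open>In the expanded square, cocoercivity bounds the quadratic term by
  \<open>\<eta> * (\<eta> * M) * inner e d\<close>, which the cross term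
  \<open>2 * \<eta> * inner e d\<close> absorbs once \<open>\<eta> * M \<le> 2\<close>.\<close>

lemma gradient_step_nonexpansive:
  assumes "0 \<le> \<eta>" "\<eta> * M \<le> 2"
  shows "norm ((w - \<eta> *\<^sub>R G w z) - (u - \<eta> *\<^sub>R G u z)) \<le> norm (w - u)"
proof -
  define d e where "d = w - u" and "e = G w z - G u z"
  have mono: "0 \<le> inner e d"
    using subgradient[of w z u] subgradient[of u z w]
    by (simp add: d_def e_def inner_diff_left inner_diff_right)
  have "(norm (d - \<eta> *\<^sub>R e))\<^sup>2 = (norm d)\<^sup>2 - 2 * \<eta> * inner e d + \<eta>\<^sup>2 * (norm e)\<^sup>2"
    unfolding power2_norm_eq_inner
    by (simp add: inner_diff_left inner_diff_right inner_commute power2_eq_square algebra_simps)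
  also have "\<eta>\<^sup>2 * (norm e)\<^sup>2 \<le> \<eta>\<^sup>2 * (M * inner e d)"
    using cocoercive[of w z u] by (intro mult_left_mono) (auto simp: d_def e_def)
  also have "\<eta>\<^sup>2 * (M * inner e d) = \<eta> * ((\<eta> * M) * inner e d)"
    by (simp add: power2_eq_square)
  also have "\<dots> \<le> \<eta> * (2 * inner e d)"
    using assms mono by (intro mult_left_mono mult_right_mono) auto
  finally have "(norm (d - \<eta> *\<^sub>R e))\<^sup>2 \<le> (norm d)\<^sup>2" by simp
  then have "norm (d - \<eta> *\<^sub>R e) \<le> norm d" by (simp add: power2_le_iff_abs_le)
  moreover have "d - \<eta> *\<^sub>R e = (w - \<eta> *\<^sub>R G w z) - (u - \<eta> *\<^sub>R G u z)"
    by (simp add: d_def e_def algebra_simps)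
  ultimately show ?thesis unfolding d_def by metis
qed

lemma convex_R: "convex_on UNIV R"
proof (intro convex_onI convex_UNIV)
  fix c :: real and x y :: 'f assume c: "0 < c" "c < 1"
  define v where "v = (1 - c) *\<^sub>R x + c *\<^sub>R y"
  have le: "m v z \<le> (1 - c) * m x z + c * m y z" for z
  proof -
    \<comment> \<open>Seen from \<open>v\<close>, both endpoints lie along \<open>x - y\<close>, so
      the weights \<open>1 - c\<close> and \<open>c\<close> cancel the gradient terms.\<close>
    have "x - v = c *\<^sub>R (x - y)" "y - v = (c - 1) *\<^sub>R (x - y)"
      by (simp_all add: v_def algebra_simps)
    then have "m v z + c * inner (G v z) (x - y) \<le> m x z"
      "m v z + (c - 1) * inner (G v z) (x - y) \<le> m y z"
      using subgradient[of v z x] subgradient[of v z y] by simp_all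
    then have "(1 - c) * (m v z + c * inner (G v z) (x - y)) \<le> (1 - c) * m x z"
      "c * (m v z + (c - 1) * inner (G v z) (x - y)) \<le> c * m y z"
      using c by (auto intro: mult_left_mono)
    then show ?thesis by (simp add: algebra_simps)
  qed
  have "R v \<le> (\<integral>z. (1 - c) * m x z + c * m y z \<partial>\<rho>)"
    unfolding R_def by (rule integral_mono) (auto simp: le m_integrable)
  also have "\<dots> = (1 - c) * R x + c * R y" by (simp add: R_def m_integrable)
  finally show "R ((1 - c) *\<^sub>R x + c *\<^sub>R y) \<le> (1 - c) * R x + c * R y" by (simp only: v_def)
qed

end

section \<open>Regret and stability of stochastic gradient descent\<close>

locale sgd = smooth_convex_loss \<rho> m G K M
  for \<rho> :: "'z measure" and m :: "'f::{real_inner, second_countable_topology} \<Rightarrow> 'z \<Rightarrow> real"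
    and G K M +
  fixes n :: nat and \<eta> :: "nat \<Rightarrow> real"
  assumes n_pos: "1 \<le> n"
    and step_pos: "\<And>k. 1 \<le> k \<Longrightarrow> 0 < \<eta> k"
    and step_le: "\<And>k. 1 \<le> k \<Longrightarrow> \<eta> k * M \<le> 2"
begin

declare One_nat_def [simp del] \<comment> \<open>it would rewrite the index sets inside \<open>PS\<close> and \<open>PJ\<close>\<close>

text \<open>As for \<open>sgm_aux\<close>, \<open>iter zs js k\<close> is the paper's $w_{k+1}$.\<close>
primrec iter :: "(nat \<Rightarrow> 'z) \<Rightarrow> (nat \<Rightarrow> nat) \<Rightarrow> nat \<Rightarrow> 'f" where
  "iter zs js 0 = 0"
| "iter zs js (Suc k) = iter zs js k - \<eta> (Suc k) *\<^sub>R G (iter zs js k) (zs (js (Suc k)))"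

abbreviation "PS \<equiv> PiM {1..n} (\<lambda>_. \<rho>)"
abbreviation "PJ \<equiv> PiM (UNIV :: nat set) (\<lambda>_. measure_pmf (pmf_of_set {1..n}))"
abbreviation "Q \<equiv> PS \<Otimes>\<^sub>M PJ"

sublocale S: prob_space PS by (intro prob_space_PiM prob_space_axioms)
sublocale J: prob_space PJ by (intro prob_space_PiM prob_space_measure_pmf)
sublocale SJ: pair_prob_space PS PJ ..

section \<open>Pathwise regret and stability\<close>

text \<open>Each step expands the squared distance to \<open>u\<close>; the subgradient inequality
  handles the cross term, \<open>G_bound\<close> the square, and the distances telescope. Free
  \<open>s\<close> and \<open>u\<close> cover both the start at 0 and the restart.\<close>

lemma regret:
  assumes "s \<le> t"
  shows "2 * (\<Sum>k=s..<t. \<eta> (Suc k) * (m (iter zs js k) (zs (js (Suc k))) - m u (zs (js (Suc k)))))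
    \<le> (norm (iter zs js s - u))\<^sup>2 - (norm (iter zs js t - u))\<^sup>2 + K\<^sup>2 * (\<Sum>k=s..<t. (\<eta> (Suc k))\<^sup>2)"
  using assms
proof (induction t rule: dec_induct)
  case (step t)
  define w z g where "w = iter zs js t" and "z = zs (js (Suc t))" and "g = G w z"
  have "(norm (iter zs js (Suc t) - u))\<^sup>2 = (norm ((w - u) - \<eta> (Suc t) *\<^sub>R g))\<^sup>2"
    by (simp add: w_def g_def z_def algebra_simps)
  also have "\<dots> = (norm (w - u))\<^sup>2 - 2 * (\<eta> (Suc t) * inner g (w - u)) + (\<eta> (Suc t))\<^sup>2 * (norm g)\<^sup>2"
    unfolding power2_norm_eq_inner
    by (simp add: inner_diff_left inner_diff_right inner_commute power2_eq_square algebra_simps)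
  finally have eq: "(norm (iter zs js (Suc t) - u))\<^sup>2
    = (norm (w - u))\<^sup>2 - 2 * (\<eta> (Suc t) * inner g (w - u)) + (\<eta> (Suc t))\<^sup>2 * (norm g)\<^sup>2" .
  have "(\<eta> (Suc t))\<^sup>2 * (norm g)\<^sup>2 \<le> (\<eta> (Suc t))\<^sup>2 * K\<^sup>2"
    by (intro mult_left_mono power_mono) (auto simp: g_def G_bound)
  moreover have "\<eta> (Suc t) * (m w z - m u z) \<le> \<eta> (Suc t) * inner g (w - u)"
    using subgradient[of w z u] step_pos[of "Suc t"]
    by (intro mult_left_mono) (auto simp: g_def inner_diff_right)
  ultimately have "(norm (iter zs js (Suc t) - u))\<^sup>2 \<le> (norm (w - u))\<^sup>2
    - 2 * (\<eta> (Suc t) * (m w z - m u z)) + (\<eta> (Suc t))\<^sup>2 * K\<^sup>2"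
    unfolding eq by linarith
  then show ?case using step.IH step.hyps
    by (simp add: w_def z_def distrib_left mult.commute del: iter.simps)
qed simp

text \<open>Holding on every path, this makes the integrands built from iterates bounded, so that
  measurability suffices for integrability.\<close>

lemma norm_iter_le: "norm (iter zs js k) \<le> K * (\<Sum>i=1..k. \<eta> i)"
proof (induction k)
  case (Suc k)
  have "norm (iter zs js (Suc k)) \<le> norm (iter zs js k) + norm (\<eta> (Suc k) *\<^sub>R G (iter zs js k) (zs (js (Suc k))))"
    unfolding iter.simps by (rule norm_triangle_ineq4)
  also have "norm (\<eta> (Suc k) *\<^sub>R G (iter zs js k) (zs (js (Suc k)))) \<le> \<eta> (Suc k) * K"
    using step_pos[of "Suc k"] by (simp add: G_bound mult_left_mono)
  finally show ?case using Suc by (simp add: distrib_left mult.commute)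
qed simp

text \<open>Only the indices up to \<open>k\<close> have been used; this stands in for independence
  of the next index.\<close>

lemma iter_upd_future: "k < j \<Longrightarrow> iter zs (js(j := i)) k = iter zs js k"
  by (induction k) auto

text \<open>A step that avoids point \<open>i\<close> applies the same nonexpansive map to both
  trajectories; one that uses it separates them by at most \<open>2 * K\<close> times the
  step-size.\<close>

lemma iter_upd_sample:
  "norm (iter zs js k - iter (zs(i := z)) js k) \<le> 2 * K * (\<Sum>j=1..k. \<eta> j * of_bool (js j = i))"
proof (induction k)
  case (Suc k)
  define w u where "w = iter zs js k" and "u = iter (zs(i := z)) js k"
  show ?case
  proof (cases "js (Suc k) = i")
    case True
    have "norm (iter zs js (Suc k) - iter (zs(i := z)) js (Suc k))
      = norm ((w - u) - \<eta> (Suc k) *\<^sub>R (G w (zs i) - G u z))"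
      by (simp add: w_def u_def True algebra_simps)
    also have "\<dots> \<le> norm (w - u) + norm (\<eta> (Suc k) *\<^sub>R (G w (zs i) - G u z))"
      by (rule norm_triangle_ineq4)
    also have "norm (\<eta> (Suc k) *\<^sub>R (G w (zs i) - G u z)) \<le> \<eta> (Suc k) * (2 * K)"
    proof -
      have "norm (G w (zs i) - G u z) \<le> 2 * K"
        using norm_triangle_ineq4[of "G w (zs i)" "G u z"] G_bound[of w "zs i"] G_bound[of u z] by simp
      then show ?thesis using step_pos[of "Suc k"] by (simp add: mult_left_mono)
    qed
    finally have "norm (iter zs js (Suc k) - iter (zs(i := z)) js (Suc k)) \<le> norm (w - u) + \<eta> (Suc k) * (2 * K)"
      by simp
    moreover have "2 * K * (\<Sum>j=1..Suc k. \<eta> j * of_bool (js j = i))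
      = 2 * K * (\<Sum>j=1..k. \<eta> j * of_bool (js j = i)) + \<eta> (Suc k) * (2 * K)"
      using True by (simp add: distrib_left)
    ultimately show ?thesis using Suc unfolding w_def u_def by linarith
  next
    case False
    have "norm (iter zs js (Suc k) - iter (zs(i := z)) js (Suc k)) \<le> norm (w - u)"
      using gradient_step_nonexpansive[of "\<eta> (Suc k)" w "zs (js (Suc k))" u] step_pos[of "Suc k"]
        step_le[of "Suc k"] False by (simp add: w_def u_def)
    moreover have "2 * K * (\<Sum>j=1..Suc k. \<eta> j * of_bool (js j = i))
      = 2 * K * (\<Sum>j=1..k. \<eta> j * of_bool (js j = i))"
      using False by simp
    ultimately show ?thesis using Suc unfolding w_def u_def by linarith
  qed
qed simp

section \<open>Measurability and integrability along the iterates\<close>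

text \<open>Off \<open>{1..n}\<close>, points of \<open>PS\<close> take the value \<open>undefined\<close>, which need not lie in
  \<open>space \<rho>\<close>; there measurability rests on continuity in \<open>w\<close> alone.\<close>
lemma measurable_at_sample:
  fixes H :: "'f \<Rightarrow> 'z \<Rightarrow> 'b::metric_space"
  assumes cont: "\<And>z. continuous_on UNIV (\<lambda>w. H w z)" and meas: "\<And>w. H w \<in> borel_measurable \<rho>"
    and W [measurable]: "W \<in> borel_measurable Q"
  shows "(\<lambda>p. H (W p) (fst p i)) \<in> borel_measurable Q"
proof (cases "i \<in> {1..n}")
  case True
  have "(\<lambda>p. (W p, fst p i)) \<in> Q \<rightarrow>\<^sub>M borel \<Otimes>\<^sub>M \<rho>"
    using True by measurable
  from measurable_compose[OF this borel_measurable_Caratheodory[of H, OF cont meas]]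
  show ?thesis by simp
next
  case False
  have "(\<lambda>w. H w undefined) \<in> borel_measurable borel"
    using cont by (rule borel_measurable_continuous_onI)
  then have "(\<lambda>p. H (W p) undefined) \<in> borel_measurable Q"
    by (rule measurable_compose[OF W])
  moreover have "fst p i = undefined" if "p \<in> space Q" for p
    using that False by (auto simp: space_pair_measure space_PiM PiE_def extensional_def)
  then have "(\<lambda>p. H (W p) (fst p i)) \<in> borel_measurable Q
    \<longleftrightarrow> (\<lambda>p. H (W p) undefined) \<in> borel_measurable Q"
    by (intro measurable_cong) (simp only:)
  ultimately show ?thesis by (simp only:)
qed

text \<open>The index has countable range, so it may be fixed. It ranges over all naturals here,
  which is why positions outside the sample had to be covered.\<close>

lemma measurable_at_index:
  fixes H :: "'f \<Rightarrow> 'z \<Rightarrow> 'b::metric_space"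
  assumes "\<And>z. continuous_on UNIV (\<lambda>w. H w z)" "\<And>w. H w \<in> borel_measurable \<rho>"
    and "W \<in> borel_measurable Q"
  shows "(\<lambda>p. H (W p) (fst p (snd p k))) \<in> borel_measurable Q"
proof (rule measurable_compose_countable[where f="\<lambda>i p. H (W p) (fst p i)"])
  have "(\<lambda>p. snd p k) \<in> Q \<rightarrow>\<^sub>M measure_pmf (pmf_of_set {1..n})" by measurable
  then show "(\<lambda>p. snd p k) \<in> Q \<rightarrow>\<^sub>M count_space UNIV" by simp
qed (rule measurable_at_sample[OF assms])

lemma iter_measurable [measurable]: "(\<lambda>p. iter (fst p) (snd p) k) \<in> borel_measurable Q"
proof (induction k)
  case (Suc k)
  note [measurable] = Suc measurable_at_index[of G, OF continuous_G G_measurable Suc]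
  show ?case by simp
qed simp

lemmas m_at_index = measurable_at_index[of m, OF continuous_m m_measurable]
lemmas m_at_sample = measurable_at_sample[of m, OF continuous_m m_measurable]

lemma integrable_m:
  assumes W: "W \<in> borel_measurable Q" and B: "\<And>p. norm (W p) \<le> B"
  shows "integrable Q (\<lambda>p. m (W p) (fst p (snd p k)))" "integrable Q (\<lambda>p. m (W p) (fst p i))"
    "integrable Q (\<lambda>p. R (W p))"
proof -
  have B': "K * norm (W p) \<le> K * B" for p using B K_nonneg by (intro mult_left_mono) auto
  show "integrable Q (\<lambda>p. m (W p) (fst p (snd p k)))"
    by (rule SJ.integrable_const_bound[where B="K * B"])
       (auto intro!: m_at_index W order_trans[OF m_bound B'])
  show "integrable Q (\<lambda>p. m (W p) (fst p i))"
    by (rule SJ.integrable_const_bound[where B="K * B"])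
       (auto intro!: m_at_sample W order_trans[OF m_bound B'])
  show "integrable Q (\<lambda>p. R (W p))"
    by (rule SJ.integrable_const_bound[where B="K * B"])
       (auto intro!: measurable_compose[OF W] order_trans[OF R_bound B'])
qed

section \<open>Redrawing an index or a sample point\<close>

text \<open>As \<open>W\<close> ignores index \<open>k\<close>, that index may be redrawn uniformly
  with \<open>W\<close> held fixed: the loss at the drawn point is an unbiased estimate of the
  empirical risk.\<close>

lemma integral_at_index:
  assumes W: "W \<in> borel_measurable Q" and B: "\<And>p. norm (W p) \<le> B"
    and indep: "\<And>zs js i. W (zs, js(k := i)) = W (zs, js)"
  shows "(\<integral>p. m (W p) (fst p (snd p k)) \<partial>Q) = (\<integral>p. (\<Sum>i=1..n. m (W p) (fst p i)) / n \<partial>Q)"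
proof -
  let ?f = "\<lambda>p. m (W p) (fst p (snd p k))"
  have B': "\<bar>m (W p) z\<bar> \<le> K * B" for p z
    by (rule order_trans[OF m_bound]) (use B K_nonneg in \<open>intro mult_left_mono, auto\<close>)
  have "(\<integral>p. ?f p \<partial>Q) = (\<integral>zs. (\<integral>js. ?f (zs, js) \<partial>PJ) \<partial>PS)"
    by (rule SJ.integral_fst'[symmetric]) (rule integrable_m[OF W B])
  also have "\<dots> = (\<integral>zs. (\<integral>js. (\<Sum>i=1..n. m (W (zs, js)) (zs i)) / n \<partial>PJ) \<partial>PS)"
  proof (rule Bochner_Integration.integral_cong[OF refl])
    fix zs assume zs: "zs \<in> space PS"
    have "(\<integral>js. ?f (zs, js) \<partial>PJ) =
      (\<integral>js. (\<integral>i. ?f (zs, js(k := i)) \<partial>measure_pmf (pmf_of_set {1..n})) \<partial>PJ)"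
    proof (rule integral_PiM_resample[where B="K * B"])
      show "(\<lambda>js. ?f (zs, js)) \<in> borel_measurable PJ"
        using measurable_compose[OF measurable_Pair1'[OF zs] m_at_index[OF W]] by simp
    qed (auto simp: B' prob_space_measure_pmf)
    also have "(\<lambda>js. \<integral>i. ?f (zs, js(k := i)) \<partial>measure_pmf (pmf_of_set {1..n}))
      = (\<lambda>js. (\<Sum>i=1..n. m (W (zs, js)) (zs i)) / n)"
      using n_pos by (subst integral_pmf_of_set) (auto simp: indep)
    finally show "(\<integral>js. ?f (zs, js) \<partial>PJ) = (\<integral>js. (\<Sum>i=1..n. m (W (zs, js)) (zs i)) / n \<partial>PJ)" .
  qed
  also have "\<dots> = (\<integral>p. (\<Sum>i=1..n. m (W p) (fst p i)) / n \<partial>Q)"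
    using SJ.integral_fst'[of "\<lambda>p. (\<Sum>i=1..n. m (W p) (fst p i)) / n"]
      integrable_m(2)[OF W B] by simp
  finally show ?thesis .
qed

lemma integral_resample_sample:
  fixes f :: "(nat \<Rightarrow> 'z) \<times> (nat \<Rightarrow> nat) \<Rightarrow> real"
  assumes i: "i \<in> {1..n}" and f [measurable]: "f \<in> borel_measurable Q" and bdd: "\<And>p. \<bar>f p\<bar> \<le> B"
  shows "integrable Q (\<lambda>p. \<integral>z. f ((fst p)(i := z), snd p) \<partial>\<rho>)"
    and "(\<integral>p. f p \<partial>Q) = (\<integral>p. (\<integral>z. f ((fst p)(i := z), snd p) \<partial>\<rho>) \<partial>Q)"
proof -
  have ins: "insert i {1..n} = {1..n}" using i by auto
  have upd: "(\<lambda>(x, y). x(i := y)) \<in> PS \<Otimes>\<^sub>M \<rho> \<rightarrow>\<^sub>M PS"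
    using measurable_add_dim[of i "{1..n}" "\<lambda>_. \<rho>"] unfolding ins .
  have "(\<lambda>q. (fst (fst q), snd q)) \<in> Q \<Otimes>\<^sub>M \<rho> \<rightarrow>\<^sub>M PS \<Otimes>\<^sub>M \<rho>" by measurable
  from measurable_compose[OF this upd]
  have [measurable]: "(\<lambda>q. (fst (fst q))(i := snd q)) \<in> Q \<Otimes>\<^sub>M \<rho> \<rightarrow>\<^sub>M PS" by (simp only: split_beta fst_conv snd_conv)
  have "(\<lambda>q. ((fst (fst q))(i := snd q), snd (fst q))) \<in> Q \<Otimes>\<^sub>M \<rho> \<rightarrow>\<^sub>M Q" by measurable
  from measurable_compose[OF this f]
  have [measurable]: "(\<lambda>(p, z). f ((fst p)(i := z), snd p)) \<in> borel_measurable (Q \<Otimes>\<^sub>M \<rho>)"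
    by (simp only: case_prod_unfold)
  have meas: "(\<lambda>p. \<integral>z. f ((fst p)(i := z), snd p) \<partial>\<rho>) \<in> borel_measurable Q" by measurable
  have "0 \<le> B" using order_trans[OF abs_ge_zero bdd] .
  \<comment> \<open>\<open>xs\<close> and \<open>js\<close> are arbitrary, so the slice in
    \<open>z\<close> may fail to be integrable; the comparison uses the nonnegative constant
    \<open>B\<close> instead.\<close>
  have B: "\<bar>\<integral>z. f (xs(i := z), js) \<partial>\<rho>\<bar> \<le> B" for xs js
  proof -
    have "\<bar>\<integral>z. f (xs(i := z), js) \<partial>\<rho>\<bar> \<le> (\<integral>z. \<bar>f (xs(i := z), js)\<bar> \<partial>\<rho>)" by simp
    also have "\<dots> \<le> (\<integral>z. B \<partial>\<rho>)"
      by (rule integral_mono') (use bdd \<open>0 \<le> B\<close> in auto)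
    finally show ?thesis by (simp add: prob_space)
  qed
  show int: "integrable Q (\<lambda>p. \<integral>z. f ((fst p)(i := z), snd p) \<partial>\<rho>)"
    by (rule SJ.integrable_const_bound[where B=B]) (use B meas in auto)
  have "integrable Q f"
    by (rule SJ.integrable_const_bound[where B=B]) (use bdd in auto)
  \<comment> \<open>The sample integral goes innermost, so that coordinate \<open>i\<close> is
    redrawn for each fixed index sequence.\<close>
  then have "(\<integral>p. f p \<partial>Q) = (\<integral>js. (\<integral>xs. f (xs, js) \<partial>PS) \<partial>PJ)"
    using SJ.integral_snd[of "\<lambda>xs js. f (xs, js)"] by simp
  also have "\<dots> = (\<integral>js. (\<integral>xs. (\<integral>z. f (xs(i := z), js) \<partial>\<rho>) \<partial>PS) \<partial>PJ)"
  proof (rule Bochner_Integration.integral_cong[OF refl])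
    fix js assume js: "js \<in> space PJ"
    show "(\<integral>xs. f (xs, js) \<partial>PS) = (\<integral>xs. (\<integral>z. f (xs(i := z), js) \<partial>\<rho>) \<partial>PS)"
      by (rule integral_PiM_resample[where B=B])
         (use i bdd prob_space_axioms measurable_compose[OF measurable_Pair2'[OF js] f] in auto)
  qed
  also have "\<dots> = (\<integral>p. (\<integral>z. f ((fst p)(i := z), snd p) \<partial>\<rho>) \<partial>Q)"
    using SJ.integral_snd[of "\<lambda>xs js. \<integral>z. f (xs(i := z), js) \<partial>\<rho>"] int
    by (simp add: split_beta')
  finally show "(\<integral>p. f p \<partial>Q) = (\<integral>p. (\<integral>z. f ((fst p)(i := z), snd p) \<partial>\<rho>) \<partial>Q)" .
qed

text \<open>Argument and data point move together here, as they do when the loss is tested at a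
  point that has also entered the training sample.\<close>

lemma m_curve_integrable:
  assumes "W \<in> borel_measurable \<rho>" "\<And>z. norm (W z) \<le> B"
  shows "integrable \<rho> (\<lambda>z. m (W z) z)"
proof (rule integrable_const_bound[where B="K * B"])
  have "(\<lambda>z. (W z, z)) \<in> \<rho> \<rightarrow>\<^sub>M borel \<Otimes>\<^sub>M \<rho>" using assms(1) by measurable
  from measurable_compose[OF this borel_measurable_Caratheodory[of m, OF continuous_m m_measurable]]
  show "(\<lambda>z. m (W z) z) \<in> borel_measurable \<rho>" by simp
  have "\<bar>m (W z) z\<bar> \<le> K * B" for z
    using m_bound[of "W z" z] mult_left_mono[OF assms(2) K_nonneg] order_trans by blast
  then show "AE z in \<rho>. norm (m (W z) z) \<le> K * B" by simp
qed

section \<open>Expected risks and the generalization gap\<close>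

definition emp_risk :: "nat \<Rightarrow> real"
  where "emp_risk k = (\<integral>p. (\<Sum>i=1..n. m (iter (fst p) (snd p) k) (fst p i)) / n \<partial>Q)"

definition mean_risk :: "nat \<Rightarrow> real"
  where "mean_risk k = (\<integral>p. R (iter (fst p) (snd p) k) \<partial>Q)"

lemmas integrable_iter = integrable_m[of "\<lambda>p. iter (fst p) (snd p) k" "K * (\<Sum>i=1..k. \<eta> i)" for k,
    OF iter_measurable norm_iter_le]

text \<open>Exchanging \<open>zs i\<close> with an independent copy \<open>z\<close> turns the loss at a training point into the
  loss at a fresh point, evaluated at an iterate that has moved only by the steps that used \<open>zs i\<close>.\<close>
lemma generalization_gap: "\<bar>emp_risk k - mean_risk k\<bar> \<le> 2 * K\<^sup>2 * (\<Sum>j=1..k. \<eta> j) / n"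
proof -
  define W where "W p = iter (fst p) (snd p) k" for p :: "(nat \<Rightarrow> 'z) \<times> (nat \<Rightarrow> nat)"
  define h where "h i p = (\<integral>z. m (iter ((fst p)(i := z)) (snd p) k) z \<partial>\<rho>)"
    for i and p :: "(nat \<Rightarrow> 'z) \<times> (nat \<Rightarrow> nat)"
  let ?S = "\<Sum>i=1..k. \<eta> i"
  have mB: "\<bar>m (iter zs js k) z\<bar> \<le> K * (K * ?S)" for zs js z
    by (rule order_trans[OF m_bound mult_left_mono[OF norm_iter_le K_nonneg]])
  have h: "integrable Q (h i)" "(\<integral>p. m (W p) (fst p i) \<partial>Q) = (\<integral>p. h i p \<partial>Q)" if "i \<in> {1..n}" for i
  proof -
    have "(\<lambda>p. m (W p) (fst p i)) \<in> borel_measurable Q"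
      unfolding W_def by (intro m_at_sample iter_measurable)
    from integral_resample_sample[OF that this, of "K * (K * ?S)"]
    show "integrable Q (h i)" "(\<integral>p. m (W p) (fst p i) \<partial>Q) = (\<integral>p. h i p \<partial>Q)"
      using mB by (simp_all add: W_def h_def[abs_def])
  qed
  have int_h: "integrable Q (\<lambda>p. (\<Sum>i=1..n. h i p) / n)"
    using h by (intro integrable_divide_zero Bochner_Integration.integrable_sum) auto
  have "emp_risk k = (\<integral>p. (\<Sum>i=1..n. h i p) / n \<partial>Q)"
    using h integrable_iter(2) by (simp add: emp_risk_def W_def)
  then have "emp_risk k - mean_risk k = (\<integral>p. (\<Sum>i=1..n. h i p) / n - R (W p) \<partial>Q)"
    using Bochner_Integration.integral_diff[OF int_h integrable_iter(3)] by (simp add: mean_risk_def W_def)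
  also have "\<bar>\<dots>\<bar> \<le> (\<integral>p. \<bar>(\<Sum>i=1..n. h i p) / n - R (W p)\<bar> \<partial>Q)" by simp
  also have "\<dots> \<le> (\<integral>p. 2 * K\<^sup>2 * ?S / n \<partial>Q)"
  proof (rule integral_mono)
    show "integrable Q (\<lambda>p. \<bar>(\<Sum>i=1..n. h i p) / n - R (W p)\<bar>)"
      using int_h integrable_iter(3) unfolding W_def
      by (intro integrable_abs Bochner_Integration.integrable_diff)
    fix p assume p: "p \<in> space Q"
    obtain zs js where p_eq: "p = (zs, js)" and zs: "zs \<in> space PS" and js: "js \<in> space PJ"
      using p by (auto simp: space_pair_measure)
    \<comment> \<open>Both terms integrate the same loss, along trajectories whose samples differ
      only at point \<open>i\<close>.\<close>
    have gap: "\<bar>h i p - R (W p)\<bar> \<le> K * (2 * K * (\<Sum>j=1..k. \<eta> j * of_bool (js j = i)))"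
      if i: "i \<in> {1..n}" for i
    proof -
      have "(\<lambda>z. (zs(i := z), js)) \<in> \<rho> \<rightarrow>\<^sub>M Q"
      proof (rule measurable_Pair)
        have "insert i {1..n} = {1..n}" using i by auto
        then have "(\<lambda>(x, y). x(i := y)) \<in> PS \<Otimes>\<^sub>M \<rho> \<rightarrow>\<^sub>M PS"
          using measurable_add_dim[of i "{1..n}" "\<lambda>_. \<rho>"] by metis
        from measurable_compose[OF measurable_Pair1'[OF zs] this]
        show "(\<lambda>z. zs(i := z)) \<in> \<rho> \<rightarrow>\<^sub>M PS" by simp
      qed (use js in simp)
      from measurable_compose[OF this iter_measurable]
      have int: "integrable \<rho> (\<lambda>z. m (iter (zs(i := z)) js k) z)"
        by (intro m_curve_integrable[OF _ norm_iter_le]) simp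
      have "h i p - R (W p) = (\<integral>z. m (iter (zs(i := z)) js k) z - m (W p) z \<partial>\<rho>)"
        using int m_integrable by (simp add: h_def R_def p_eq)
      also have "\<bar>\<dots>\<bar> \<le> (\<integral>z. \<bar>m (iter (zs(i := z)) js k) z - m (W p) z\<bar> \<partial>\<rho>)" by simp
      also have "\<dots> \<le> (\<integral>z. K * (2 * K * (\<Sum>j=1..k. \<eta> j * of_bool (js j = i))) \<partial>\<rho>)"
      proof (rule integral_mono)
        show "integrable \<rho> (\<lambda>z. \<bar>m (iter (zs(i := z)) js k) z - m (W p) z\<bar>)"
          using int m_integrable by (intro integrable_abs Bochner_Integration.integrable_diff)
        show "\<bar>m (iter (zs(i := z)) js k) z - m (W p) z\<bar>
          \<le> K * (2 * K * (\<Sum>j=1..k. \<eta> j * of_bool (js j = i)))" for z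
          using iter_upd_sample[of zs js k i z] unfolding W_def p_eq fst_conv snd_conv norm_minus_commute[of "iter zs js k"]
          by (rule order_trans[OF m_lipschitz mult_left_mono[OF _ K_nonneg]])
      qed simp
      finally show ?thesis by (simp only: lebesgue_integral_const prob_space) simp
    qed
    have "(\<Sum>i=1..n. h i p) / n - R (W p) = (\<Sum>i=1..n. h i p - R (W p)) / n"
      using n_pos by (simp add: sum_subtractf diff_divide_distrib)
    also have "\<bar>\<dots>\<bar> \<le> (\<Sum>i=1..n. \<bar>h i p - R (W p)\<bar>) / n"
      by (simp add: divide_right_mono)
    also have "\<dots> \<le> (\<Sum>i=1..n. K * (2 * K * (\<Sum>j=1..k. \<eta> j * of_bool (js j = i)))) / n"
      by (intro divide_right_mono sum_mono gap) auto
    also have "\<dots> = 2 * K\<^sup>2 * (\<Sum>j=1..k. \<Sum>i=1..n. \<eta> j * of_bool (js j = i)) / n"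
      by (subst sum.swap) (simp only: sum_distrib_left power2_eq_square mult_ac)
    \<comment> \<open>Each step \<open>j\<close> uses at most one point, so the sum over
      \<open>i\<close> counts its step-size at most once; hence the factor \<open>1 / n\<close>
      survives.\<close>
    also have "\<dots> \<le> 2 * K\<^sup>2 * ?S / n"
    proof (intro divide_right_mono mult_left_mono sum_mono)
      fix j assume "j \<in> {1..k}"
      then show "(\<Sum>i=1..n. \<eta> j * of_bool (js j = i)) \<le> \<eta> j"
        using step_pos[of j] by (simp add: of_bool_def if_distrib cong: if_cong)
    qed auto
    finally show "\<bar>(\<Sum>i=1..n. h i p) / n - R (W p)\<bar> \<le> 2 * K\<^sup>2 * ?S / n" .
  qed simp
  finally show ?thesis by (simp add: SJ.prob_space)
qed

section \<open>Regret in expectation\<close>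

text \<open>The comparator may be random as long as it ignores the indices after \<open>s\<close>:
  then \<open>integral_at_index\<close> turns both losses at each later step into empirical risks.
  This admits iterate \<open>s\<close> itself.\<close>

lemma expected_regret:
  assumes "s \<le> t"
    and U: "U \<in> borel_measurable Q" "\<And>p. norm (U p) \<le> B"
    and indep: "\<And>zs js k i. s < k \<Longrightarrow> U (zs, js(k := i)) = U (zs, js)"
    and start: "\<And>zs js. (norm (iter zs js s - U (zs, js)))\<^sup>2 \<le> c"
  shows "(\<Sum>k=s..<t. \<eta> (Suc k) * (emp_risk k - (\<integral>p. (\<Sum>i=1..n. m (U p) (fst p i)) / n \<partial>Q)))
    \<le> c / 2 + K\<^sup>2 / 2 * (\<Sum>k=s..<t. (\<eta> (Suc k))\<^sup>2)"
proof -
  let ?w = "\<lambda>k p. iter (fst p) (snd p) k" and ?z = "\<lambda>k p. fst p (snd p (Suc k))"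
  note int = integrable_iter(1) integrable_m(1)[OF U]
  have "emp_risk k = (\<integral>p. m (?w k p) (?z k p) \<partial>Q)" for k
    unfolding emp_risk_def
    by (rule integral_at_index[OF iter_measurable norm_iter_le, symmetric]) (simp add: iter_upd_future)
  moreover have "(\<integral>p. (\<Sum>i=1..n. m (U p) (fst p i)) / n \<partial>Q) = (\<integral>p. m (U p) (?z k p) \<partial>Q)"
    if "s \<le> k" for k
    by (rule integral_at_index[OF U, symmetric]) (use that in \<open>simp add: indep\<close>)
  ultimately have "(\<Sum>k=s..<t. \<eta> (Suc k) * (emp_risk k - (\<integral>p. (\<Sum>i=1..n. m (U p) (fst p i)) / n \<partial>Q)))
    = (\<Sum>k=s..<t. \<integral>p. \<eta> (Suc k) * (m (?w k p) (?z k p) - m (U p) (?z k p)) \<partial>Q)"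
    by (intro sum.cong refl) (simp add: int)
  also have "\<dots> = (\<integral>p. (\<Sum>k=s..<t. \<eta> (Suc k) * (m (?w k p) (?z k p) - m (U p) (?z k p))) \<partial>Q)"
    by (rule Bochner_Integration.integral_sum[symmetric]) (simp add: int)
  also have "\<dots> \<le> (\<integral>p. c / 2 + K\<^sup>2 / 2 * (\<Sum>k=s..<t. (\<eta> (Suc k))\<^sup>2) \<partial>Q)"
  proof (rule integral_mono)
    fix p :: "(nat \<Rightarrow> 'z) \<times> (nat \<Rightarrow> nat)"
    show "(\<Sum>k=s..<t. \<eta> (Suc k) * (m (?w k p) (?z k p) - m (U p) (?z k p)))
      \<le> c / 2 + K\<^sup>2 / 2 * (\<Sum>k=s..<t. (\<eta> (Suc k))\<^sup>2)"
      using regret[OF \<open>s \<le> t\<close>, of "fst p" "snd p" "U p"] start[of "fst p" "snd p"]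
        zero_le_power2[of "norm (iter (fst p) (snd p) t - U p)"]
      unfolding prod.collapse by linarith
  qed (simp_all add: int)
  finally show ?thesis by (simp add: SJ.prob_space)
qed

text \<open>A fixed \<open>u\<close> has expected empirical risk \<open>R u\<close>, so only the
  iterates pay the generalization gap.\<close>

lemma regret_fixed:
  "(\<Sum>k=0..<t. \<eta> (Suc k) * (mean_risk k - R u))
    \<le> (norm u)\<^sup>2 / 2 + (\<Sum>k=0..<t. K\<^sup>2 / 2 * (\<eta> (Suc k))\<^sup>2 + \<eta> (Suc k) * (2 * K\<^sup>2 * (\<Sum>j=1..k. \<eta> j) / n))"
proof -
  have "(\<integral>p. m u (fst p i) \<partial>Q) = R u" if "i \<in> {1..n}" for i
    using integral_resample_sample(2)[OF that, of "\<lambda>p. m u (fst p i)" "K * norm u"]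
      m_at_sample[of "\<lambda>_. u" i] m_bound by (simp add: R_def SJ.prob_space)
  then have u: "(\<integral>p. (\<Sum>i=1..n. m u (fst p i)) / n \<partial>Q) = R u"
    using n_pos integrable_m(2)[of "\<lambda>_. u" "norm u"] by simp
  have "(\<Sum>k=0..<t. \<eta> (Suc k) * (mean_risk k - R u))
    \<le> (\<Sum>k=0..<t. \<eta> (Suc k) * (emp_risk k - R u) + \<eta> (Suc k) * (2 * K\<^sup>2 * (\<Sum>j=1..k. \<eta> j) / n))"
  proof (rule sum_mono)
    fix k
    have "mean_risk k - R u \<le> (emp_risk k - R u) + 2 * K\<^sup>2 * (\<Sum>j=1..k. \<eta> j) / n"
      using generalization_gap[of k] by linarith
    from mult_left_mono[OF this, of "\<eta> (Suc k)"] step_pos[of "Suc k"]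
    show "\<eta> (Suc k) * (mean_risk k - R u)
      \<le> \<eta> (Suc k) * (emp_risk k - R u) + \<eta> (Suc k) * (2 * K\<^sup>2 * (\<Sum>j=1..k. \<eta> j) / n)"
      by (simp only: distrib_left) simp
  qed
  moreover have "(\<Sum>k=0..<t. \<eta> (Suc k) * (emp_risk k - R u))
    \<le> (norm u)\<^sup>2 / 2 + K\<^sup>2 / 2 * (\<Sum>k=0..<t. (\<eta> (Suc k))\<^sup>2)"
    using expected_regret[of 0 t "\<lambda>_. u" "norm u" "(norm u)\<^sup>2"] unfolding u by simp
  ultimately show ?thesis
    unfolding sum.distrib sum_distrib_left by linarith
qed

text \<open>The initial distance is 0, but now both \<open>k\<close> and \<open>s\<close> pay the
  gap. The bound at \<open>s\<close> is at most the one at \<open>k\<close>, hence the factor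
  2.\<close>

lemma regret_restart:
  assumes "s \<le> t"
  shows "(\<Sum>k=s..<t. \<eta> (Suc k) * (mean_risk k - mean_risk s))
    \<le> (\<Sum>k=s..<t. K\<^sup>2 / 2 * (\<eta> (Suc k))\<^sup>2 + \<eta> (Suc k) * (2 * (2 * K\<^sup>2 * (\<Sum>j=1..k. \<eta> j) / n)))"
proof -
  have "(\<Sum>k=s..<t. \<eta> (Suc k) * (mean_risk k - mean_risk s))
    \<le> (\<Sum>k=s..<t. \<eta> (Suc k) * (emp_risk k - emp_risk s)
        + \<eta> (Suc k) * (2 * (2 * K\<^sup>2 * (\<Sum>j=1..k. \<eta> j) / n)))"
  proof (rule sum_mono)
    fix k assume "k \<in> {s..<t}"
    then have "(\<Sum>j=1..s. \<eta> j) \<le> (\<Sum>j=1..k. \<eta> j)"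
      by (intro sum_mono2) (use step_pos in \<open>auto simp: less_imp_le\<close>)
    then have "2 * K\<^sup>2 * (\<Sum>j=1..s. \<eta> j) / n \<le> 2 * K\<^sup>2 * (\<Sum>j=1..k. \<eta> j) / n"
      by (intro divide_right_mono mult_left_mono) auto
    then have "mean_risk k - mean_risk s
      \<le> (emp_risk k - emp_risk s) + 2 * (2 * K\<^sup>2 * (\<Sum>j=1..k. \<eta> j) / n)"
      using generalization_gap[of k] generalization_gap[of s] by linarith
    from mult_left_mono[OF this, of "\<eta> (Suc k)"] step_pos[of "Suc k"]
    show "\<eta> (Suc k) * (mean_risk k - mean_risk s) \<le> \<eta> (Suc k) * (emp_risk k - emp_risk s)
        + \<eta> (Suc k) * (2 * (2 * K\<^sup>2 * (\<Sum>j=1..k. \<eta> j) / n))"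
      by (simp only: distrib_left) simp
  qed
  moreover have "(\<Sum>k=s..<t. \<eta> (Suc k) * (emp_risk k - emp_risk s))
    \<le> K\<^sup>2 / 2 * (\<Sum>k=s..<t. (\<eta> (Suc k))\<^sup>2)"
    using expected_regret[OF assms, of "\<lambda>p. iter (fst p) (snd p) s" "K * (\<Sum>i=1..s. \<eta> i)" 0]
      iter_measurable norm_iter_le unfolding emp_risk_def[of s, symmetric]
    by (simp add: iter_upd_future)
  ultimately show ?thesis
    unfolding sum.distrib sum_distrib_left by linarith
qed

text \<open>If all visited points lie in \<open>A\<close>, a gradient that differs from
  \<open>G\<close> only off \<open>A\<close> produces the same path; this carries the bounds back to
  the original iterates.\<close>

lemma AE_sample:
  assumes "AE z in \<rho>. z \<in> A"
  shows "AE p in Q. (\<forall>i\<in>{1..n}. fst p i \<in> A) \<and> (\<forall>k. snd p k \<in> {1..n})"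
proof (rule AE_conjI)
  have "AE zs in PS. \<forall>i\<in>{1..n}. zs i \<in> A"
    by (intro AE_finite_allI AE_PiM_component prob_space_axioms assms) auto
  then have "AE zs in distr Q PS fst. \<forall>i\<in>{1..n}. zs i \<in> A"
    by (simp only: J.distr_pair_fst)
  then show "AE p in Q. \<forall>i\<in>{1..n}. fst p i \<in> A"
    by (rule AE_distrD[rotated]) simp
  have "AE js in PJ. \<forall>k. js k \<in> {1..n}"
    unfolding AE_all_countable
    by (intro allI AE_PiM_component prob_space_measure_pmf) (use n_pos in \<open>auto simp: AE_measure_pmf_iff\<close>)
  then have ae: "AE zs in PS. AE js in PJ. \<forall>k. snd (zs, js) k \<in> {1..n}" by simp
  have "(\<lambda>p. snd p k) \<in> Q \<rightarrow>\<^sub>M count_space UNIV" for k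
    using measurable_compose[OF measurable_snd measurable_component_singleton[of k UNIV]] by simp
  then have "Measurable.pred Q (\<lambda>p. snd p k \<in> {1..n})" for k
    by (rule measurable_compose) simp
  then have "Measurable.pred Q (\<lambda>p. \<forall>k. snd p k \<in> {1..n})"
    by (rule pred_intros_countable)
  from SJ.AE_pair_measure[OF predE[OF this] ae] show "AE p in Q. \<forall>k. snd p k \<in> {1..n}" .
qed

lemma nn_integral_excess:
  "(\<integral>\<^sup>+p. ennreal (R (iter (fst p) (snd p) k) - b) \<partial>Q) = ennreal (mean_risk k - b)" if "\<And>w. b \<le> R w"
  using that integrable_iter(3)[of k]
  by (subst nn_integral_eq_integral) (auto simp: mean_risk_def SJ.prob_space)

end

section \<open>Bounds for non-increasing step-sizes\<close>

text \<open>\<open>approximation\<close> speaks of arbitrary lower bounds \<open>b\<close> of the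
  regularised risk instead of its infimum, since the regret inequality produces such a lower
  bound.\<close>

locale decaying_sgd = sgd \<rho> m G K M n \<eta>
  for \<rho> :: "'z measure" and m :: "'f::{real_inner, second_countable_topology} \<Rightarrow> 'z \<Rightarrow> real"
    and G K M n \<eta> +
  fixes Rinf cb \<beta> :: real
  assumes step_decreasing: "\<And>k l. 1 \<le> k \<Longrightarrow> k \<le> l \<Longrightarrow> \<eta> l \<le> \<eta> k"
    and Rinf_le: "\<And>w. Rinf \<le> R w"
    and cb_nonneg: "0 \<le> cb"
    and approximation: "\<And>lam b. 0 < lam \<Longrightarrow> (\<And>u. b \<le> R u + lam / 2 * (norm u)\<^sup>2) \<Longrightarrow> b - Rinf \<le> cb * lam powr \<beta>"
begin

text \<open>The cost of step \<open>k\<close>: the squared step plus twice the generalization gap,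
  the latter taken at the largest index \<open>t - 1\<close> to be uniform in
  \<open>k\<close>.\<close>

definition slack :: "nat \<Rightarrow> nat \<Rightarrow> real" where
  "slack t k = K\<^sup>2 / 2 * (\<eta> k)\<^sup>2 + \<eta> k * (2 * (2 * K\<^sup>2 * (\<Sum>j=1..t-1. \<eta> j) / n))"

text \<open>The shift undoes the one in \<open>iter\<close>: \<open>excess k\<close> belongs to the
  \<open>k\<close>-th iterate counted from 1.\<close>

definition excess :: "nat \<Rightarrow> real" where
  "excess k = mean_risk (k - 1) - Rinf"

lemma step_sum_mono: "k \<le> l \<Longrightarrow> (\<Sum>j=1..k. \<eta> j) \<le> (\<Sum>j=1..l. \<eta> j)"
  by (intro sum_mono2) (use step_pos in \<open>auto simp: less_imp_le\<close>)

lemma step_sum_nonneg: "0 \<le> (\<Sum>j=1..k. \<eta> j)"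
  using step_pos by (intro sum_nonneg) (auto simp: less_imp_le)

lemma step_sum_pos: "1 \<le> t \<Longrightarrow> 0 < (\<Sum>j=1..t. \<eta> j)"
  using step_pos by (intro sum_pos) auto

text \<open>\<open>c = 1\<close> serves the fixed comparator, \<open>c = 2\<close> the
  restart.\<close>

lemma gap_le_slack:
  assumes "k < t" "c \<le> 2" "0 \<le> c"
  shows "K\<^sup>2 / 2 * (\<eta> (Suc k))\<^sup>2 + \<eta> (Suc k) * (c * (2 * K\<^sup>2 * (\<Sum>j=1..k. \<eta> j) / n)) \<le> slack t (Suc k)"
proof -
  have "2 * K\<^sup>2 * (\<Sum>j=1..k. \<eta> j) / n \<le> 2 * K\<^sup>2 * (\<Sum>j=1..t-1. \<eta> j) / n"
    using assms by (intro divide_right_mono mult_left_mono step_sum_mono) auto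
  moreover have "0 \<le> 2 * K\<^sup>2 * (\<Sum>j=1..k. \<eta> j) / n"
    using step_sum_nonneg by simp
  ultimately have "c * (2 * K\<^sup>2 * (\<Sum>j=1..k. \<eta> j) / n) \<le> 2 * (2 * K\<^sup>2 * (\<Sum>j=1..t-1. \<eta> j) / n)"
    using assms by (intro mult_mono) auto
  then show ?thesis
    using step_pos[of "Suc k"] unfolding slack_def by (intro add_left_mono mult_left_mono) auto
qed

text \<open>Divided by \<open>S\<close>, the regret against \<open>u\<close> says that
  \<open>D / S + Rinf\<close> lies below the risk of \<open>u\<close> regularised with parameter
  \<open>1 / S\<close>. As \<open>u\<close> is arbitrary, \<open>approximation\<close> applies with
  \<open>lam = 1 / S\<close>.\<close>

lemma weighted_excess_le:
  assumes t: "1 \<le> t"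
  shows "(\<Sum>k=1..t. \<eta> k * excess k)
    \<le> (\<Sum>k=1..t. \<eta> k) * (cb * (1 / (\<Sum>k=1..t. \<eta> k)) powr \<beta>) + (\<Sum>k=1..t. slack t k)"
proof -
  define S where "S = (\<Sum>k=1..t. \<eta> k)"
  define D where "D = (\<Sum>k=1..t. \<eta> k * excess k) - (\<Sum>k=1..t. slack t k)"
  have S: "0 < S" using t by (simp add: S_def step_sum_pos)
  have "D / S + Rinf \<le> R u + (1 / S) / 2 * (norm u)\<^sup>2" for u
  proof -
    have "(\<Sum>k=1..t. \<eta> k * (mean_risk (k - 1) - R u))
      = (\<Sum>k=0..<t. \<eta> (Suc k) * (mean_risk k - R u))"
      by (simp add: sum.atLeast1_atMost_eq One_nat_def atLeast0LessThan)
    also have "\<dots> \<le> (norm u)\<^sup>2 / 2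
      + (\<Sum>k=0..<t. K\<^sup>2 / 2 * (\<eta> (Suc k))\<^sup>2 + \<eta> (Suc k) * (2 * K\<^sup>2 * (\<Sum>j=1..k. \<eta> j) / n))"
      by (rule regret_fixed)
    also have "\<dots> \<le> (norm u)\<^sup>2 / 2 + (\<Sum>k=0..<t. slack t (Suc k))"
      using gap_le_slack[of _ t 1] by (intro add_left_mono sum_mono) auto
    also have "(\<Sum>k=0..<t. slack t (Suc k)) = (\<Sum>k=1..t. slack t k)"
      by (simp add: sum.atLeast1_atMost_eq One_nat_def atLeast0LessThan)
    also have "(\<Sum>k=1..t. \<eta> k * (mean_risk (k - 1) - R u)) = (\<Sum>k=1..t. \<eta> k * excess k) - S * (R u - Rinf)"
      unfolding S_def excess_def sum_distrib_right sum_subtractf[symmetric]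
      by (intro sum.cong refl) (simp add: algebra_simps)
    finally have "D \<le> (norm u)\<^sup>2 / 2 + S * (R u - Rinf)" by (simp add: D_def)
    then have "D / S \<le> ((norm u)\<^sup>2 / 2 + S * (R u - Rinf)) / S"
      using S by (intro divide_right_mono) auto
    then show ?thesis using S by (simp add: add_divide_distrib)
  qed
  from approximation[OF _ this] S have "D / S \<le> cb * (1 / S) powr \<beta>" by simp
  then have "D \<le> S * (cb * (1 / S) powr \<beta>)"
    using S by (simp add: pos_divide_le_eq mult.commute)
  then show ?thesis unfolding D_def S_def by linarith
qed

lemma restarted_excess_le:
  assumes "1 \<le> s" "s \<le> t"
  shows "(\<Sum>k=s..t. \<eta> k * (excess k - excess s)) \<le> (\<Sum>k=s..t. slack t k)"
proof -
  obtain r where r: "s = Suc r" using assms(1) by (cases s) auto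
  have shift: "(\<Sum>k=s..t. f k) = (\<Sum>k=r..<t. f (Suc k))" for f :: "nat \<Rightarrow> real"
    unfolding r atLeastLessThanSuc_atLeastAtMost[symmetric] by (rule sum.shift_bounds_Suc_ivl)
  have "(\<Sum>k=s..t. \<eta> k * (excess k - excess s)) = (\<Sum>k=r..<t. \<eta> (Suc k) * (mean_risk k - mean_risk r))"
    unfolding shift by (simp add: excess_def r)
  also have "\<dots> \<le> (\<Sum>k=r..<t. K\<^sup>2 / 2 * (\<eta> (Suc k))\<^sup>2
      + \<eta> (Suc k) * (2 * (2 * K\<^sup>2 * (\<Sum>j=1..k. \<eta> j) / n)))"
    using assms r by (intro regret_restart) simp
  also have "\<dots> \<le> (\<Sum>k=r..<t. slack t (Suc k))"
    using gap_le_slack[of _ t 2] by (intro sum_mono) auto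
  finally show ?thesis unfolding shift .
qed

lemma excess_nonneg: "0 \<le> excess k"
proof -
  have "(\<integral>p. Rinf \<partial>Q) \<le> mean_risk (k - 1)"
    unfolding mean_risk_def by (rule integral_mono) (auto simp: Rinf_le integrable_iter)
  then show ?thesis by (simp add: excess_def SJ.prob_space)
qed

lemma average_excess_risk:
  assumes t: "1 \<le> t"
  shows "(\<integral>\<^sup>+p. ennreal (R ((1 / (\<Sum>k=1..t. \<eta> k)) *\<^sub>R
      (\<Sum>k=1..t. \<eta> k *\<^sub>R iter (fst p) (snd p) (k - 1))) - Rinf) \<partial>Q)
    \<le> ennreal ((cb + 8 * K\<^sup>2) * ((\<Sum>k=1..t. \<eta> k) / n
        + (\<Sum>k=1..t. (\<eta> k)\<^sup>2) / (\<Sum>k=1..t. \<eta> k) + (1 / (\<Sum>k=1..t. \<eta> k)) powr \<beta>))"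
proof -
  define S where "S = (\<Sum>k=1..t. \<eta> k)"
  have S: "0 < S" using t by (simp add: S_def step_sum_pos)
  let ?w = "\<lambda>k p. iter (fst p) (snd p) (k - 1)"
  have jensen: "R ((1 / S) *\<^sub>R (\<Sum>k=1..t. \<eta> k *\<^sub>R ?w k p)) - Rinf
    \<le> (\<Sum>k=1..t. \<eta> k / S * (R (?w k p) - Rinf))" for p
  proof -
    have one: "(\<Sum>k=1..t. \<eta> k / S) = 1"
      using S unfolding sum_divide_distrib[symmetric] S_def[symmetric] by simp
    have "R (\<Sum>k=1..t. (\<eta> k / S) *\<^sub>R ?w k p) \<le> (\<Sum>k=1..t. \<eta> k / S * R (?w k p))"
      using t S step_pos one by (intro convex_on_sum[OF _ _ convex_R]) (auto simp: less_imp_le)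
    moreover have "(\<Sum>k=1..t. \<eta> k / S * (R (?w k p) - Rinf)) = (\<Sum>k=1..t. \<eta> k / S * R (?w k p)) - Rinf"
      by (simp only: right_diff_distrib sum_subtractf sum_distrib_right[symmetric] one mult_1)
    ultimately show ?thesis by (simp add: scaleR_sum_right)
  qed
  have "(\<integral>\<^sup>+p. ennreal (R ((1 / S) *\<^sub>R (\<Sum>k=1..t. \<eta> k *\<^sub>R ?w k p)) - Rinf) \<partial>Q)
    \<le> (\<integral>\<^sup>+p. ennreal (\<Sum>k=1..t. \<eta> k / S * (R (?w k p) - Rinf)) \<partial>Q)"
    by (intro nn_integral_mono ennreal_leI jensen)
  also have "\<dots> = ennreal (\<integral>p. (\<Sum>k=1..t. \<eta> k / S * (R (?w k p) - Rinf)) \<partial>Q)"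
    using integrable_iter(3) Rinf_le S step_pos
    by (intro nn_integral_eq_integral) (auto intro!: sum_nonneg AE_I2 mult_nonneg_nonneg divide_nonneg_nonneg simp: less_imp_le)
  also have "(\<integral>p. (\<Sum>k=1..t. \<eta> k / S * (R (?w k p) - Rinf)) \<partial>Q) = (\<Sum>k=1..t. \<eta> k / S * excess k)"
    using integrable_iter(3) by (simp add: excess_def mean_risk_def SJ.prob_space)
  also have "\<dots> = (\<Sum>k=1..t. \<eta> k * excess k) / S" by (simp add: sum_divide_distrib)
  also have "\<dots> \<le> (S * (cb * (1 / S) powr \<beta>) + (\<Sum>k=1..t. slack t k)) / S"
    using S weighted_excess_le[OF t] by (intro divide_right_mono) (auto simp: S_def)
  also have "\<dots> = cb * (1 / S) powr \<beta> + K\<^sup>2 / 2 * ((\<Sum>k=1..t. (\<eta> k)\<^sup>2) / S)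
      + 4 * K\<^sup>2 * ((\<Sum>j=1..t-1. \<eta> j) / n)"
    using S unfolding slack_def sum.distrib sum_distrib_left[symmetric] sum_distrib_right[symmetric] S_def[symmetric]
    by (simp add: add_divide_distrib)
  \<comment> \<open>The three constants are enlarged to a common one that also suffices for the last
    iterate.\<close>
  also have "\<dots> \<le> (cb + 8 * K\<^sup>2) * (1 / S) powr \<beta> + (cb + 8 * K\<^sup>2) * ((\<Sum>k=1..t. (\<eta> k)\<^sup>2) / S)
      + (cb + 8 * K\<^sup>2) * (S / n)"
  proof (intro add_mono mult_mono)
    show "(\<Sum>j=1..t-1. \<eta> j) / n \<le> S / n"
      unfolding S_def by (intro divide_right_mono step_sum_mono) auto
    show "0 \<le> (\<Sum>k=1..t. (\<eta> k)\<^sup>2) / S" using S by (intro divide_nonneg_nonneg sum_nonneg) auto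
    show "0 \<le> (\<Sum>j=1..t-1. \<eta> j) / n" using step_sum_nonneg by simp
  qed (use cb_nonneg in auto)
  also have "\<dots> = (cb + 8 * K\<^sup>2) * (S / n + (\<Sum>k=1..t. (\<eta> k)\<^sup>2) / S + (1 / S) powr \<beta>)"
    by (simp add: distrib_left)
  finally show ?thesis unfolding S_def by (simp add: ennreal_leI)
qed

text \<open>\<open>last_iterate_le\<close> with \<open>x = slack t\<close> and
  \<open>V = cb * S powr (1 - \<beta>)\<close>, divided by \<open>\<eta> t\<close>.\<close>

lemma last_excess_risk:
  assumes t: "1 \<le> t"
  shows "(\<integral>\<^sup>+p. ennreal (R (iter (fst p) (snd p) (t - 1)) - Rinf) \<partial>Q)
    \<le> ennreal ((cb + 8 * K\<^sup>2) * ((\<Sum>k=1..t. \<eta> k) / n * (\<Sum>k=1..t-1. \<eta> k / (\<eta> t * real (t - k)))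
        + ((\<Sum>k=1..t-1. (\<eta> k)\<^sup>2 / (\<eta> t * real (t - k))) + \<eta> t)
        + (\<Sum>k=1..t. \<eta> k) powr (1 - \<beta>) / (\<eta> t * real t)))"
proof -
  define S where "S = (\<Sum>k=1..t. \<eta> k)"
  define P where "P = (\<Sum>k=1..t-1. \<eta> k / (\<eta> t * real (t - k)))"
  define P2 where "P2 = (\<Sum>k=1..t-1. (\<eta> k)\<^sup>2 / (\<eta> t * real (t - k)))"
  define d where "d = 2 * (2 * K\<^sup>2 * (\<Sum>j=1..t-1. \<eta> j) / n)"
  have S: "0 < S" using t by (simp add: S_def step_sum_pos)
  have pos: "0 < \<eta> t" using step_pos t by simp
  have d: "0 \<le> d" using step_sum_nonneg[of "t - 1"] by (simp add: d_def)
  have P: "0 \<le> P" and P2: "0 \<le> P2"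
    unfolding P_def P2_def using pos step_pos by (auto intro!: sum_nonneg divide_nonneg_nonneg simp: less_imp_le)
  have V: "S * (cb * (1 / S) powr \<beta>) = cb * S powr (1 - \<beta>)"
    using S by (simp add: powr_diff powr_divide field_simps)
  have "\<eta> t * excess t \<le> (cb * S powr (1 - \<beta>)) / t + slack t t + (\<Sum>k=1..t-1. slack t k / real (t - k))"
    using t step_pos step_decreasing excess_nonneg weighted_excess_le[OF t] restarted_excess_le
    unfolding S_def[symmetric] V by (rule last_iterate_le)
  then have "excess t \<le> ((cb * S powr (1 - \<beta>)) / t + slack t t + (\<Sum>k=1..t-1. slack t k / real (t - k))) / \<eta> t"
    using pos by (simp add: pos_le_divide_eq mult.commute)
  also have "\<dots> = cb * (S powr (1 - \<beta>) / (\<eta> t * real t)) + slack t t / \<eta> t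
      + (\<Sum>k=1..t-1. slack t k / (\<eta> t * real (t - k)))"
    by (simp add: add_divide_distrib sum_divide_distrib mult.commute)
  also have "slack t t / \<eta> t = K\<^sup>2 / 2 * \<eta> t + d"
    using pos by (simp add: slack_def d_def add_divide_distrib power2_eq_square)
  also have "(\<Sum>k=1..t-1. slack t k / (\<eta> t * real (t - k))) = K\<^sup>2 / 2 * P2 + d * P"
    unfolding P_def P2_def sum_distrib_left sum.distrib[symmetric]
    by (intro sum.cong refl) (unfold slack_def d_def[symmetric], simp add: add_divide_distrib mult.commute)
  finally have "excess t \<le> cb * (S powr (1 - \<beta>) / (\<eta> t * real t)) + K\<^sup>2 / 2 * (P2 + \<eta> t) + d * (1 + P)"
    by (simp add: algebra_simps add_divide_distrib)
  \<comment> \<open>The slack of the last step leaves a \<open>d\<close> without the factor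
    \<open>P\<close>. For \<open>t = 1\<close> it is an empty sum; otherwise the summand
    \<open>k = t - 1\<close> alone gives \<open>1 \<le> P\<close>, and
    \<open>1 + P \<le> 2 * P\<close> turns the constant 4 into 8.\<close>
  moreover have "d * (1 + P) \<le> 8 * K\<^sup>2 * (S / n * P)"
  proof (cases "t = 1")
    case True
    then show ?thesis by (simp add: d_def P_def)
  next
    case False
    then have t2: "2 \<le> t" using t by simp
    have "1 \<le> \<eta> (t - 1) / (\<eta> t * real (t - (t - 1)))"
      using t2 pos step_decreasing[of "t - 1" t] by (simp add: pos_le_divide_eq)
    also have "\<dots> \<le> P"
      unfolding P_def
      by (rule member_le_sum) (use t2 pos step_pos in \<open>auto intro!: divide_nonneg_nonneg simp: less_imp_le\<close>)
    finally have "1 + P \<le> 2 * P" by simp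
    moreover have "d \<le> 4 * K\<^sup>2 * (S / n)"
      using step_sum_mono[of "t - 1" t] by (auto simp: d_def S_def intro!: divide_right_mono mult_left_mono)
    ultimately have "d * (1 + P) \<le> 4 * K\<^sup>2 * (S / n) * (2 * P)"
      using d P S by (intro mult_mono) auto
    then show ?thesis by simp
  qed
  moreover have "cb * (S powr (1 - \<beta>) / (\<eta> t * real t)) \<le> (cb + 8 * K\<^sup>2) * (S powr (1 - \<beta>) / (\<eta> t * real t))"
    using pos by (intro mult_right_mono divide_nonneg_nonneg) auto
  moreover have "K\<^sup>2 / 2 * (P2 + \<eta> t) \<le> (cb + 8 * K\<^sup>2) * (P2 + \<eta> t)"
    using pos P2 cb_nonneg by (intro mult_right_mono) auto
  moreover have "8 * K\<^sup>2 * (S / n * P) \<le> (cb + 8 * K\<^sup>2) * (S / n * P)"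
    using S P cb_nonneg by (intro mult_right_mono mult_nonneg_nonneg) auto
  ultimately have "excess t \<le> (cb + 8 * K\<^sup>2) * (S / n * P + (P2 + \<eta> t) + S powr (1 - \<beta>) / (\<eta> t * real t))"
    unfolding distrib_left[of "cb + 8 * K\<^sup>2"] by linarith
  then show ?thesis
    unfolding nn_integral_excess[OF Rinf_le] excess_def P_def P2_def S_def by (rule ennreal_leI)
qed

end

section \<open>The two risk bounds\<close>

theorem mainTheorem8:
  fixes MX :: "'x measure"
    and \<rho> :: "('x \<times> real) measure"
    and Y :: "real set"
    and \<Phi> :: "'x \<Rightarrow> 'f::{real_inner, complete_space, second_countable_topology}"
    and l :: "real \<Rightarrow> real \<Rightarrow> real"
    and a0 L \<beta> cb :: real
  defines "\<kappa> \<equiv> (SUP x\<in>space MX. norm (\<Phi> x))"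
  assumes prob: "prob_space \<rho>"
    and sets_rho: "sets \<rho> = sets (MX \<Otimes>\<^sub>M borel)"
    and rho_Y: "AE z in \<rho>. snd z \<in> Y"
    and Phi_meas: "\<Phi> \<in> borel_measurable MX"
    and risk_integrable: "\<And>w. integrable \<rho> (\<lambda>z. l (snd z) (inner w (\<Phi> (fst z))))"
    \<comment> \<open>(S1)\<close>
    and kappa_fin: "bdd_above ((\<lambda>x. norm (\<Phi> x)) ` space MX)"
    and convex: "\<And>y. y \<in> Y \<Longrightarrow> convex_on UNIV (l y)"
    and loss0_bdd: "bdd_above ((\<lambda>y. l y 0) ` Y)"
    and deriv_bdd: "\<And>y a. y \<in> Y \<Longrightarrow> \<bar>left_deriv (l y) a\<bar> \<le> a0"
    \<comment> \<open>(S2)\<close>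
    and inf_fin: "bdd_below (range (risk \<rho> l \<Phi>))"
    and beta: "0 < \<beta>" "\<beta> \<le> 1" and cbeta: "0 < cb"
    and source: "\<And>lam. lam > 0 \<Longrightarrow> approx_err \<rho> l \<Phi> lam \<le> cb * lam powr \<beta>"
    \<comment> \<open>(S3)\<close>
    and diff: "\<And>y a. y \<in> Y \<Longrightarrow> l y differentiable (at a)"
    and lip: "\<And>y a b. y \<in> Y \<Longrightarrow> \<bar>deriv (l y) a - deriv (l y) b\<bar> \<le> L * \<bar>a - b\<bar>"
  shows "\<exists>C. \<forall>n::nat. \<forall>\<eta>::nat \<Rightarrow> real. \<forall>t::nat.
     (n \<ge> 1 \<and> t \<ge> 1
      \<and> (\<forall>k\<ge>1. \<eta> k > 0)
      \<and> (\<forall>k l. 1 \<le> k \<longrightarrow> k \<le> l \<longrightarrow> \<eta> l \<le> \<eta> k)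
      \<and> (\<forall>k\<ge>1. \<eta> k * \<kappa>\<^sup>2 * L \<le> 2)) \<longrightarrow>
     ((\<integral>\<^sup>+ p. ennreal (risk \<rho> l \<Phi> (sgm_avg l \<Phi> \<eta> (fst p) (snd p) t) - inf_risk \<rho> l \<Phi>)
          \<partial>sample_index_measure \<rho> n)
       \<le> ennreal (C * ((\<Sum>k=1..t. \<eta> k) / real n
                       + (\<Sum>k=1..t. (\<eta> k)\<^sup>2) / (\<Sum>k=1..t. \<eta> k)
                       + (1 / (\<Sum>k=1..t. \<eta> k)) powr \<beta>))
      \<and>
      (\<integral>\<^sup>+ p. ennreal (risk \<rho> l \<Phi> (sgm_iter l \<Phi> \<eta> (fst p) (snd p) t) - inf_risk \<rho> l \<Phi>)
          \<partial>sample_index_measure \<rho> n)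
       \<le> ennreal (C * ((\<Sum>k=1..t. \<eta> k) / real n
                          * (\<Sum>k=1..t-1. \<eta> k / (\<eta> t * real (t - k)))
                       + ((\<Sum>k=1..t-1. (\<eta> k)\<^sup>2 / (\<eta> t * real (t - k))) + \<eta> t)
                       + (\<Sum>k=1..t. \<eta> k) powr (1 - \<beta>) / (\<eta> t * real t))))"
proof -
  interpret prob_space \<rho> by fact
  have space_rho: "space \<rho> = space MX \<times> UNIV"
    using sets_eq_imp_space_eq[OF sets_rho] by (simp add: space_pair_measure)
  obtain N where N: "{z \<in> space \<rho>. \<not> snd z \<in> Y} \<subseteq> N" "N \<in> null_sets \<rho>"
    using AE_E[OF rho_Y] by (metis null_setsI)
  define A where "A = space \<rho> - N"
  have A [measurable]: "A \<in> sets \<rho>" using N(2) by (auto simp: A_def)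
  have ae_A: "AE z in \<rho>. z \<in> A"
    using AE_not_in[OF N(2)] AE_space by eventually_elim (simp add: A_def)
  have AY: "snd z \<in> Y" and AX: "fst z \<in> space MX" if "z \<in> A" for z
    using that N(1) by (auto simp: A_def space_rho)
  \<comment> \<open>Full measure makes \<open>A\<close> nonempty; evaluating the bounds at
    \<open>z0\<close> yields that \<open>\<kappa>\<close>, \<open>a0\<close> and \<open>L\<close>
    are nonnegative.\<close>
  obtain z0 where z0: "z0 \<in> A"
    using AE_False ae_A by (metis (no_types, lifting) AE_cong all_not_in_conv)
  have norm_Phi: "norm (\<Phi> x) \<le> \<kappa>" if "x \<in> space MX" for x
    unfolding \<kappa>_def using that kappa_fin by (intro cSUP_upper)
  have kappa: "0 \<le> \<kappa>" using norm_Phi[OF AX[OF z0]] norm_ge_zero order_trans by blast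
  have a0: "0 \<le> a0" using deriv_bdd[OF AY[OF z0], of 0] by simp
  have L: "0 \<le> L" using lip[OF AY[OF z0], of 1 0] by simp
  have [measurable]: "(\<lambda>z. \<Phi> (fst z)) \<in> borel_measurable \<rho>"
    using measurable_compose[OF measurable_fst Phi_meas] measurable_cong_sets[OF sets_rho refl] by blast
  \<comment> \<open>Centring gives \<open>m 0 z = 0\<close>, so the Lipschitz bound in
    \<open>w\<close> controls \<open>m w z\<close> itself.\<close>
  define m where "m w z = (if z \<in> A then l (snd z) (inner w (\<Phi> (fst z))) - l (snd z) 0 else 0)" for w z
  define G where "G w z = (if z \<in> A then deriv (l (snd z)) (inner w (\<Phi> (fst z))) *\<^sub>R \<Phi> (fst z) else 0)"
    for w z
  have [measurable]: "(\<lambda>z. l (snd z) (inner w (\<Phi> (fst z)))) \<in> borel_measurable \<rho>" for w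
    using risk_integrable by (rule borel_measurable_integrable)
  from this[of 0] have [measurable]: "(\<lambda>z. l (snd z) 0) \<in> borel_measurable \<rho>" by simp
  have m_meas: "m w \<in> borel_measurable \<rho>" for w
    unfolding m_def[abs_def] by measurable
  have deriv_l: "(l y has_real_derivative deriv (l y) a) (at a)" if "y \<in> Y" for y a
    using diff[OF that] by (simp add: DERIV_deriv_iff_real_differentiable)
  have tangent: "deriv (l y) a * (b - a) \<le> l y b - l y a" if "y \<in> Y" for y a b
    by (rule convex_on_imp_above_tangent[OF convex[OF that]]) (auto intro: deriv_l[OF that])
  have left_deriv: "left_deriv (l y) a = deriv (l y) a" if "y \<in> Y" for y a
    using diff[OF that] by (rule left_deriv_eq_deriv)
  interpret scl: smooth_convex_loss \<rho> m G "\<kappa> * a0" "\<kappa>\<^sup>2 * L"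
  proof
    show "G w \<in> borel_measurable \<rho>" for w
      unfolding G_def[abs_def]
      by (rule gradient_measurable[where l="\<lambda>z. l (snd z)"])
         (use m_meas diff AY in \<open>auto simp: m_def[abs_def]\<close>)
    show "norm (G w z) \<le> \<kappa> * a0" for w z
    proof (cases "z \<in> A")
      case True
      have "\<bar>deriv (l (snd z)) (inner w (\<Phi> (fst z)))\<bar> \<le> a0"
        using deriv_bdd[OF AY[OF True]] left_deriv[OF AY[OF True]] by simp
      then show ?thesis
        using True norm_Phi[OF AX[OF True]] a0
        by (simp add: G_def mult.commute[of \<kappa>] mult_mono)
    qed (simp add: G_def kappa a0)
    show "m w z + inner (G w z) (u - w) \<le> m u z" for u w z
      using tangent[OF AY, of z "inner w (\<Phi> (fst z))" "inner u (\<Phi> (fst z))"]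
      by (auto simp: m_def G_def inner_diff_right inner_commute algebra_simps)
    show "(norm (G w z - G u z))\<^sup>2 \<le> \<kappa>\<^sup>2 * L * inner (G w z - G u z) (w - u)" for u w z
    proof (cases "z \<in> A")
      case True
      \<comment> \<open>Both gradients are multiples of \<open>\<Phi> (fst z)\<close>, which reduces
        cocoercivity to the scalar inequality \<open>D\<^sup>2 \<le> L * (D * (a - b))\<close>, a
        consequence of monotonicity and the Lipschitz bound.\<close>
      define a b D where "a = inner w (\<Phi> (fst z))" and "b = inner u (\<Phi> (fst z))"
        and "D = deriv (l (snd z)) a - deriv (l (snd z)) b"
      have eq: "G w z - G u z = D *\<^sub>R \<Phi> (fst z)"
        using True by (simp add: G_def D_def a_def b_def scaleR_left_diff_distrib)
      have mono: "0 \<le> D * (a - b)"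
        using tangent[OF AY[OF True], of a b] tangent[OF AY[OF True], of b a]
        by (simp add: D_def algebra_simps)
      have "D\<^sup>2 = \<bar>D\<bar> * \<bar>D\<bar>" by (simp add: power2_eq_square)
      also have "\<dots> \<le> \<bar>D\<bar> * (L * \<bar>a - b\<bar>)"
        using lip[OF AY[OF True], of a b] by (intro mult_left_mono) (auto simp: D_def)
      also have "\<dots> = L * (D * (a - b))"
        using mono by (metis abs_mult abs_of_nonneg mult.left_commute)
      finally have "D\<^sup>2 * (norm (\<Phi> (fst z)))\<^sup>2 \<le> (L * (D * (a - b))) * \<kappa>\<^sup>2"
        using norm_Phi[OF AX[OF True]] L mono by (intro mult_mono power_mono) auto
      moreover have inn: "inner (D *\<^sub>R \<Phi> (fst z)) (w - u) = D * (a - b)"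
        by (simp add: a_def b_def inner_diff_left inner_diff_right inner_commute)
      ultimately show ?thesis
        unfolding eq inn norm_scaleR power_mult_distrib power2_abs by (simp only: mult_ac)
    qed (simp add: G_def)
  qed (use m_meas L in \<open>auto simp: m_def\<close>)
  \<comment> \<open>Centring shifts the risk by a constant, so excess risks are unchanged.

    @ DONE\<close>
  have R_eq: "scl.R w = risk \<rho> l \<Phi> w - risk \<rho> l \<Phi> 0" for w
  proof -
    have "scl.R w = (\<integral>z. l (snd z) (inner w (\<Phi> (fst z))) - l (snd z) (inner 0 (\<Phi> (fst z))) \<partial>\<rho>)"
      unfolding scl.R_def
      by (rule integral_cong_AE) (use ae_A m_meas in \<open>auto simp: m_def\<close>)
    then show ?thesis by (simp add: risk_def risk_integrable del: inner_zero_left)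
  qed
  define C where "C = cb + 8 * (\<kappa> * a0)\<^sup>2"
  show ?thesis
  proof (intro exI[of _ C] allI impI)
    fix n :: nat and \<eta> :: "nat \<Rightarrow> real" and t :: nat
    assume H: "n \<ge> 1 \<and> t \<ge> 1 \<and> (\<forall>k\<ge>1. \<eta> k > 0) \<and> (\<forall>k l. 1 \<le> k \<longrightarrow> k \<le> l \<longrightarrow> \<eta> l \<le> \<eta> k)
      \<and> (\<forall>k\<ge>1. \<eta> k * \<kappa>\<^sup>2 * L \<le> 2)"
    then have t: "1 \<le> t" by simp
    define Rinf where "Rinf = inf_risk \<rho> l \<Phi> - risk \<rho> l \<Phi> 0"
    interpret sgd: decaying_sgd \<rho> m G "\<kappa> * a0" "\<kappa>\<^sup>2 * L" n \<eta> Rinf cb \<beta>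
    proof
      show "Rinf \<le> scl.R w" for w
        using cINF_lower[OF inf_fin, of w] by (simp add: Rinf_def R_eq inf_risk_def)
      fix lam b :: real
      assume "0 < lam" and b: "\<And>u. b \<le> scl.R u + lam / 2 * (norm u)\<^sup>2"
      have "b + risk \<rho> l \<Phi> 0 \<le> Inf (range (\<lambda>u. risk \<rho> l \<Phi> u + lam / 2 * (norm u)\<^sup>2))"
        using b by (intro cINF_greatest) (auto simp: R_eq algebra_simps)
      with source[OF \<open>0 < lam\<close>] show "b - Rinf \<le> cb * lam powr \<beta>"
        by (simp add: approx_err_def Rinf_def)
    qed (use H cbeta in \<open>auto simp: mult.assoc\<close>)
    have iter_eq: "sgm_aux l \<Phi> \<eta> zs js k = sgd.iter zs js k"
      if "\<forall>i\<in>{1..n}. zs i \<in> A" "\<forall>k. js k \<in> {1..n}" for zs js k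
    proof (induction k)
      case (Suc k)
      have "zs (js (Suc k)) \<in> A" using that by blast
      then have "G w (zs (js (Suc k))) = left_deriv (l (snd (zs (js (Suc k))))) (inner w (\<Phi> (fst (zs (js (Suc k))))))
          *\<^sub>R \<Phi> (fst (zs (js (Suc k))))" for w
        by (simp add: G_def left_deriv[OF AY])
      then show ?case by (simp add: Suc Let_def)
    qed simp
    have eq: "AE p in sample_index_measure \<rho> n.
        \<forall>k. sgm_aux l \<Phi> \<eta> (fst p) (snd p) k = sgd.iter (fst p) (snd p) k"
      using sgd.AE_sample[OF ae_A] unfolding sample_index_measure_def
      by eventually_elim (use iter_eq in blast)
    have risk_eq: "risk \<rho> l \<Phi> w - inf_risk \<rho> l \<Phi> = scl.R w - Rinf" for w
      by (simp add: R_eq Rinf_def)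
    have "(\<integral>\<^sup>+p. ennreal (risk \<rho> l \<Phi> (sgm_avg l \<Phi> \<eta> (fst p) (snd p) t) - inf_risk \<rho> l \<Phi>)
        \<partial>sample_index_measure \<rho> n)
      = (\<integral>\<^sup>+p. ennreal (scl.R ((1 / (\<Sum>k=1..t. \<eta> k)) *\<^sub>R
          (\<Sum>k=1..t. \<eta> k *\<^sub>R sgd.iter (fst p) (snd p) (k - 1))) - Rinf) \<partial>sample_index_measure \<rho> n)"
      unfolding risk_eq sgm_avg_def sgm_iter_def
      by (rule nn_integral_cong_AE) (use eq in eventually_elim, simp)
    moreover have "(\<integral>\<^sup>+p. ennreal (risk \<rho> l \<Phi> (sgm_iter l \<Phi> \<eta> (fst p) (snd p) t) - inf_risk \<rho> l \<Phi>)
        \<partial>sample_index_measure \<rho> n)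
      = (\<integral>\<^sup>+p. ennreal (scl.R (sgd.iter (fst p) (snd p) (t - 1)) - Rinf) \<partial>sample_index_measure \<rho> n)"
      unfolding risk_eq sgm_iter_def
      by (rule nn_integral_cong_AE) (use eq in eventually_elim, simp)
    ultimately show "(\<integral>\<^sup>+ p. ennreal (risk \<rho> l \<Phi> (sgm_avg l \<Phi> \<eta> (fst p) (snd p) t) - inf_risk \<rho> l \<Phi>)
          \<partial>sample_index_measure \<rho> n)
       \<le> ennreal (C * ((\<Sum>k=1..t. \<eta> k) / real n
                       + (\<Sum>k=1..t. (\<eta> k)\<^sup>2) / (\<Sum>k=1..t. \<eta> k)
                       + (1 / (\<Sum>k=1..t. \<eta> k)) powr \<beta>))
      \<and>
      (\<integral>\<^sup>+ p. ennreal (risk \<rho> l \<Phi> (sgm_iter l \<Phi> \<eta> (fst p) (snd p) t) - inf_risk \<rho> l \<Phi>)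
          \<partial>sample_index_measure \<rho> n)
       \<le> ennreal (C * ((\<Sum>k=1..t. \<eta> k) / real n
                          * (\<Sum>k=1..t-1. \<eta> k / (\<eta> t * real (t - k)))
                       + ((\<Sum>k=1..t-1. (\<eta> k)\<^sup>2 / (\<eta> t * real (t - k))) + \<eta> t)
                       + (\<Sum>k=1..t. \<eta> k) powr (1 - \<beta>) / (\<eta> t * real t)))"
      using sgd.average_excess_risk[OF t] sgd.last_excess_risk[OF t]
      unfolding C_def sample_index_measure_def by (simp only:)
  qed
qed

end
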